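(* Let $\Omega$ be a domain in $\mathbb{C}^n$ and let $\phi$ be an upper semicontinuous function on $\Omega$ such that $e^{-\phi}$ is locally integrable on $\Omega$. Assume that for every $x\in\Omega$ and every positive definite hermitian form $A$, $$e^{-\phi(x)}\ge\limsup_{\epsilon\to+0}\frac{1}{\mathrm{vol}(\epsilon E(A))}\int_{x+\epsilon E(A)}e^{-\phi}\,d\lambda .$$ Suppose that for every $x\in\Omega$, every positive definite hermitian form $A$ and every $\theta\in(0,\frac{\pi}{2})$ with $x+E(A)\subset\Omega$, there exist holomorphic functions $F,G$ on $x+E(A)$ satisfying $F+G=1$ and $$\frac{1}{\sin^2\theta}\int_{x+E(A)}|G|^2e^{-\phi}\,d\lambda+\frac{1}{\cos^2\theta}\int_{x+E(A)}|F|^2|w|^{-2n}e^{-\phi}\,d\lambda\ \le\ \int_{x+E(A)}\frac{1}{\left(\sin^2\theta+|w|^{2n}\cos^2\theta\right)^2}\,e^{-\phi}\,d\lambda .$$ Then $\phi$ is plurisubharmonic.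
   Context: For a (strictly) positive definite hermitian form $A=\{a_{i\bar j}\}$ on $\mathbb{C}^n$, $E(A)=\{z=(z_1,\dots,z_n)\in\mathbb{C}^n:\sum a_{i\bar j}z_i\overline{z_j}<1\}$. Choose $L$ with $A=LL^*$. In integrals over $x+E(A)$, $w$ is the linear coordinate centered at $x$: for a point $y\in x+E(A)$, $w=(w_1,\dots,w_n)=(y-x)L$ (row vector times matrix), so that $x+E(A)=\{\sum|w_i|^2<1\}$ and $|w|^2=\sum|w_i|^2$. $d\lambda$ is Lebesgue measure and $\mathrm{vol}$ is the Lebesgue volume. *)

theory Defs
  imports "HOL-Analysis.Analysis"
begin

text \<open>The function $e^{-t}$ for $t \in [-\infty, \infty]$, with $e^{-(-\infty)} = \infty$.\<close>

definition exp_neg :: "ereal \<Rightarrow> ennreal" where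
  "exp_neg t = (case t of ereal r \<Rightarrow> ennreal (exp (- r)) | PInfty \<Rightarrow> 0 | MInfty \<Rightarrow> top)"

text \<open>Upper semicontinuous functions take values in $[-\infty, \infty)$.\<close>

definition usc_on :: "'a::topological_space set \<Rightarrow> ('a \<Rightarrow> ereal) \<Rightarrow> bool" where
  "usc_on S u \<longleftrightarrow> (\<forall>x\<in>S. u x < \<infinity> \<and>
     (\<forall>c. u x < c \<longrightarrow> (\<forall>\<^sub>F y in at x within S. u y < c)))"

definition locally_nn_integrable_on :: "('a::euclidean_space \<Rightarrow> ennreal) \<Rightarrow> 'a set \<Rightarrow> bool" where
  "locally_nn_integrable_on f S \<longleftrightarrow>
     f \<in> borel_measurable (restrict_space lborel S) \<and>
     (\<forall>K. compact K \<and> K \<subseteq> S \<longrightarrow> (\<integral>\<^sup>+x\<in>K. f x \<partial>lborel) < \<infinity>)"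

text \<open>The integral of a function with values in $[-\infty, \infty]$ as the difference of the
  integrals of its positive and negative parts (\<^const>\<open>e2ennreal\<close> maps negative values to 0).
  It is meaningful whenever one of the two is finite; for an upper semicontinuous integrand on a
  circle the positive part is.\<close>

definition ereal_integral :: "'a measure \<Rightarrow> ('a \<Rightarrow> ereal) \<Rightarrow> ereal" where
  "ereal_integral M f =
     enn2ereal (\<integral>\<^sup>+x. e2ennreal (f x) \<partial>M) - enn2ereal (\<integral>\<^sup>+x. e2ennreal (- f x) \<partial>M)"

definition circle_mean :: "(complex \<Rightarrow> ereal) \<Rightarrow> complex \<Rightarrow> real \<Rightarrow> ereal" where
  "circle_mean u a r = ereal (1 / (2 * pi)) *
     ereal_integral (restrict_space lborel {0..2 * pi}) (\<lambda>t. u (a + of_real r * cis t))"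

text \<open>The function that is identically $-\infty$ counts as subharmonic.\<close>

definition subharmonic_on :: "complex set \<Rightarrow> (complex \<Rightarrow> ereal) \<Rightarrow> bool" where
  "subharmonic_on U u \<longleftrightarrow> usc_on U u \<and>
     (\<forall>a r. 0 < r \<and> cball a r \<subseteq> U \<longrightarrow> u a \<le> circle_mean u a r)"

definition plurisubharmonic_on :: "(complex^'n) set \<Rightarrow> (complex^'n \<Rightarrow> ereal) \<Rightarrow> bool" where
  "plurisubharmonic_on \<Omega> \<phi> \<longleftrightarrow> usc_on \<Omega> \<phi> \<and>
     (\<forall>a b. b \<noteq> 0 \<longrightarrow> subharmonic_on {\<tau>. a + \<tau> *s b \<in> \<Omega>} (\<lambda>\<tau>. \<phi> (a + \<tau> *s b)))"

text \<open>Holomorphy in several variables on an open set: the real derivative exists and is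
  complex linear.\<close>

definition mv_holomorphic_on :: "(complex^'n \<Rightarrow> complex) \<Rightarrow> (complex^'n) set \<Rightarrow> bool" where
  "mv_holomorphic_on f S \<longleftrightarrow>
     (\<forall>z\<in>S. \<exists>D. (f has_derivative D) (at z) \<and> (\<forall>c v. D (c *s v) = c * D v))"

definition conj_transpose :: "complex^'n^'m \<Rightarrow> complex^'m^'n" where
  "conj_transpose L = (\<chi> i j. cnj (L $ j $ i))"

definition herm_form :: "complex^'n^'n \<Rightarrow> complex^'n \<Rightarrow> complex" where
  "herm_form A z = (\<Sum>i\<in>UNIV. \<Sum>j\<in>UNIV. A $ i $ j * z $ i * cnj (z $ j))"

text \<open>The values of a hermitian form are real, so \<^const>\<open>Re\<close> loses nothing below.\<close>

definition pos_def_hermitian :: "complex^'n^'n \<Rightarrow> bool" where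
  "pos_def_hermitian A \<longleftrightarrow>
     conj_transpose A = A \<and> (\<forall>z. z \<noteq> 0 \<longrightarrow> 0 < Re (herm_form A z))"

definition ellipsoid :: "complex^'n^'n \<Rightarrow> (complex^'n) set" where
  "ellipsoid A = {z. Re (herm_form A z) < 1}"

end

theory Submission
  imports Defs "HOL-Complex_Analysis.Complex_Analysis"
begin

text \<open>Write \<open>f = e\<^sup>-\<^sup>\<phi>\<close> and \<open>Q(z) = \<Sum> a\<^sub>i\<^sub>j z\<^sub>i cnj z\<^sub>j\<close>, so that \<open>|w|\<^sup>2 = Q(y - x)\<close>.
  With \<open>s = sin\<^sup>2 \<theta>\<close> the kernels \<open>s / (s + (1 - s) |w|\<^sup>2\<^sup>n)\<^sup>2\<close> have integral \<open>vol(E)\<close> and form an approximate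
  identity, so by the limsup condition the assumed estimate bounds \<open>\<integral>|G|\<^sup>2 f\<close> by
  \<open>vol(E) (f(x) + \<delta>)\<close>. Since \<open>|w|\<^sup>-\<^sup>2\<^sup>n\<close> is not integrable and \<open>f\<close> is bounded below near \<open>x\<close>, also
  \<open>F(x) = 0\<close> and \<open>G(x) = 1\<close>.

  If \<open>\<phi>\<close> violated the mean value inequality on a complex line, then by a maximum principle argument there
  would be a point \<open>x\<close> of that line with \<open>\<phi>(x + tb) \<le> \<phi>(x) + Re q(t) - \<eta>|t|\<^sup>2\<close> for small \<open>t\<close>, where \<open>q\<close>
  is holomorphic and \<open>q(0) = 0\<close>. By semicontinuity this holds up to \<open>\<delta>\<close> on a thin ellipsoid \<open>E\<close>
  around the disc, with \<open>t\<close> replaced by the coordinate \<open>l\<close> along \<open>b\<close>. For \<open>H = G e\<^sup>-\<^sup>q\<^sup>/\<^sup>2\<close> the estimate gives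
  \<open>\<integral>|H|\<^sup>2 (1 + \<eta>|l|\<^sup>2) \<le> (1 + o(1)) vol(E)\<close>, whereas the mean value property of \<open>H\<close> on the circles
  \<open>e\<^sup>i\<^sup>tz\<close> gives \<open>\<integral>|H|\<^sup>2 (1 + \<eta>|l|\<^sup>2) \<ge> \<integral>(1 + \<eta>|l|\<^sup>2) \<ge> (1 + \<eta>\<kappa>) vol(E)\<close> with \<open>\<kappa> > 0\<close>
  independent of the thickness of \<open>E\<close>.\<close>

section \<open>Lebesgue measure and rotations\<close>

lemma nn_integral_lborel_translate:
  fixes f :: "'a::euclidean_space \<Rightarrow> ennreal"
  shows "(\<integral>\<^sup>+x. f (c + x) \<partial>lborel) = (\<integral>\<^sup>+x. f x \<partial>lborel)"
proof (rule antisym)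
  have le: "(\<integral>\<^sup>+x. f (c + x) \<partial>lborel) \<le> (\<integral>\<^sup>+x. f x \<partial>lborel)" for f :: "'a \<Rightarrow> ennreal" and c
  proof (subst nn_integral_def, rule SUP_least, clarify)
    fix g assume g: "simple_function lborel g" "g \<le> (\<lambda>x. f (c + x))"
    then have [measurable]: "g \<in> borel_measurable borel"
      using borel_measurable_simple_function by force
    have "integral\<^sup>S lborel g = (\<integral>\<^sup>+x. g x \<partial>lborel)"
      using g(1) by (rule nn_integral_eq_simple_integral[symmetric])
    also have "\<dots> = (\<integral>\<^sup>+x. g x \<partial>distr lborel borel ((+) (- c)))"
      by (simp only: lborel_distr_plus)
    also have "\<dots> = (\<integral>\<^sup>+x. g (- c + x) \<partial>lborel)"
      by (rule nn_integral_distr) auto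
    also have "\<dots> \<le> (\<integral>\<^sup>+x. f x \<partial>lborel)"
      using g(2) by (intro nn_integral_mono) (auto simp: le_fun_def dest: spec[of _ "- c + x" for x])
    finally show "integral\<^sup>S lborel g \<le> (\<integral>\<^sup>+x. f x \<partial>lborel)" .
  qed
  show "(\<integral>\<^sup>+x. f (c + x) \<partial>lborel) \<le> (\<integral>\<^sup>+x. f x \<partial>lborel)" by (rule le)
  show "(\<integral>\<^sup>+x. f x \<partial>lborel) \<le> (\<integral>\<^sup>+x. f (c + x) \<partial>lborel)"
    using le[of "\<lambda>x. f (c + x)" "- c"] by simp
qed

lemma nn_integral_lborel_scaleR:
  fixes f :: "'a::euclidean_space \<Rightarrow> ennreal"
  assumes [measurable]: "f \<in> borel_measurable borel" and "r > 0"
  shows "(\<integral>\<^sup>+x. f x \<partial>lborel) = ennreal (r ^ DIM('a)) * (\<integral>\<^sup>+x. f (r *\<^sub>R x) \<partial>lborel)"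
  by (subst lborel_affine[of r 0])
     (use assms(2) in \<open>simp_all add: nn_integral_density nn_integral_distr nn_integral_cmult\<close>)

text \<open>Uniqueness of Haar measure: the double integral of $1_A(Tx + y) 1_B(y)$ over the unit
  ball $B$ is computed in two ways.\<close>

lemma nn_integral_lborel_isometry:
  fixes T :: "'a::euclidean_space \<Rightarrow> 'a" and f :: "'a \<Rightarrow> ennreal"
  assumes lin: "linear T" and norm: "\<And>x. norm (T x) = norm x"
    and [measurable]: "f \<in> borel_measurable borel"
  shows "(\<integral>\<^sup>+x. f (T x) \<partial>lborel) = (\<integral>\<^sup>+x. f x \<partial>lborel)"
proof -
  have "inj T"
    using linear_injective_0[OF lin] norm by (metis norm_eq_zero)
  then have surj: "surj T"
    using lin linear_injective_imp_surjective by blast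
  define S where "S = inv T"
  have TS: "T (S y) = y" for y
    using surj by (simp add: S_def surj_f_inv_f)
  have [measurable]: "T \<in> borel_measurable borel"
    using lin by (simp add: borel_measurable_continuous_onI linear_continuous_on linear_conv_bounded_linear)
  define B :: "'a set" where "B = ball 0 1"
  have [measurable]: "B \<in> sets borel" by (simp add: B_def)
  define v where "v = emeasure lborel B"
  have v0: "v \<noteq> 0" "v \<noteq> \<infinity>"
    unfolding v_def B_def using emeasure_lborel_ball_finite[of "0::'a" 1]
    by (auto simp: emeasure_ball less_imp_neq[OF unit_ball_vol_pos, symmetric])
  \<comment> \<open>As \<open>T\<close> preserves the norm, the points \<open>x\<close> with
    \<open>y - T x\<close> in \<open>B\<close> form the unit ball around \<open>S y\<close>, whose
    volume is independent of \<open>y\<close>.\<close>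
  have ball: "(\<integral>\<^sup>+x. indicator B (y - T x) \<partial>lborel) = v" for y
  proof -
    have "indicator B (y - T x) = (indicator (ball (S y) 1) x :: ennreal)" for x
    proof -
      have "norm (y - T x) = norm (S y - x)"
        using norm[of "S y - x"] TS by (simp add: linear_diff[OF lin])
      then show ?thesis by (simp add: B_def indicator_def dist_norm norm_minus_commute)
    qed
    then have "(\<integral>\<^sup>+x. indicator B (y - T x) \<partial>lborel) = emeasure lborel (ball (S y) 1)"
      by simp
    then show ?thesis by (simp add: v_def B_def emeasure_ball)
  qed
  have "(\<integral>\<^sup>+x. f (T x) \<partial>lborel) * v = (\<integral>\<^sup>+y. (\<integral>\<^sup>+x. f (T x) \<partial>lborel) * indicator B y \<partial>lborel)"
    by (simp add: nn_integral_cmult v_def)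
  also have "\<dots> = (\<integral>\<^sup>+y. (\<integral>\<^sup>+x. f (T x + y) \<partial>lborel) * indicator B y \<partial>lborel)"
  proof (rule nn_integral_cong)
    fix y
    have "(\<integral>\<^sup>+x. f (T x + y) \<partial>lborel) = (\<integral>\<^sup>+x. f (T (S y + x)) \<partial>lborel)"
      by (simp add: linear_add[OF lin] TS add.commute)
    also have "\<dots> = (\<integral>\<^sup>+x. f (T x) \<partial>lborel)"
      by (rule nn_integral_lborel_translate)
    finally show "(\<integral>\<^sup>+x. f (T x) \<partial>lborel) * indicator B y = (\<integral>\<^sup>+x. f (T x + y) \<partial>lborel) * indicator B y"
      by simp
  qed
  also have "\<dots> = (\<integral>\<^sup>+y. (\<integral>\<^sup>+x. f (T x + y) * indicator B y \<partial>lborel) \<partial>lborel)"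
    by (intro nn_integral_cong nn_integral_multc[symmetric]) measurable
  also have "\<dots> = (\<integral>\<^sup>+x. (\<integral>\<^sup>+y. f (T x + y) * indicator B y \<partial>lborel) \<partial>lborel)"
    by (rule lborel_pair.Fubini') measurable
  also have "\<dots> = (\<integral>\<^sup>+x. (\<integral>\<^sup>+y. f y * indicator B (y - T x) \<partial>lborel) \<partial>lborel)"
  proof (rule nn_integral_cong)
    fix x
    show "(\<integral>\<^sup>+y. f (T x + y) * indicator B y \<partial>lborel) = (\<integral>\<^sup>+y. f y * indicator B (y - T x) \<partial>lborel)"
      using nn_integral_lborel_translate[of "\<lambda>y. f y * indicator B (y - T x)" "T x"] by simp
  qed
  also have "\<dots> = (\<integral>\<^sup>+y. (\<integral>\<^sup>+x. f y * indicator B (y - T x) \<partial>lborel) \<partial>lborel)"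
    by (rule lborel_pair.Fubini') measurable
  also have "\<dots> = (\<integral>\<^sup>+x. f x \<partial>lborel) * v"
    by (simp add: nn_integral_cmult nn_integral_multc ball)
  finally show ?thesis
    using v0 ennreal_mult_cancel_left[of v] by (simp add: mult.commute)
qed

section \<open>Complex scalars and holomorphic functions on complex lines\<close>

lemma scaleR_eq_scalar_mult: "r *\<^sub>R (z :: complex^'n) = complex_of_real r *s z"
  by (simp add: vec_eq_iff complex_eq_iff)

lemma norm_vector_scalar_mult: "norm (c *s (z :: complex^'n)) = cmod c * norm z"
  by (simp add: norm_vec_def L2_set_def norm_mult power_mult_distrib sum_distrib_left[symmetric]
      real_sqrt_mult)

lemma bounded_linear_vector_scalar_mult: "bounded_linear (\<lambda>z :: complex^'n. c *s z)"
  by (rule bounded_linear_intro[where K="cmod c"])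
     (auto simp: vec_eq_iff algebra_simps norm_vector_scalar_mult)

lemma bounded_linear_vector_scalar_mult_left: "bounded_linear (\<lambda>c. c *s (z :: complex^'n))"
  by (rule bounded_linear_intro[where K="norm z"])
     (auto simp: vec_eq_iff algebra_simps norm_vector_scalar_mult)

lemma nn_integral_lborel_rotate:
  fixes f :: "complex^'n \<Rightarrow> ennreal"
  assumes "f \<in> borel_measurable borel"
  shows "(\<integral>\<^sup>+z. f (cis t *s z) \<partial>lborel) = (\<integral>\<^sup>+z. f z \<partial>lborel)"
  using bounded_linear.linear[OF bounded_linear_vector_scalar_mult] assms
  by (intro nn_integral_lborel_isometry) (auto simp: norm_vector_scalar_mult)

text \<open>Cauchy's formula at 0 on the unit circle, where \<open>du / u = i dt\<close>.\<close>

lemma holomorphic_circle_mean: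
  fixes f :: "complex \<Rightarrow> complex"
  assumes "f holomorphic_on cball 0 1"
  shows "((\<lambda>t. f (cis t)) has_integral 2 * pi * f 0) {0..2 * pi}"
proof -
  have "((\<lambda>u. f u / (u - 0)) has_contour_integral 2 * complex_of_real pi * \<i> * f 0) (circlepath 0 1)"
    by (rule Cauchy_integral_circlepath_simple) (use assms in auto)
  then have "((\<lambda>t. f (cis t) / cis t * \<i> * cis t) has_integral 2 * complex_of_real pi * \<i> * f 0) {0..2 * pi}"
    by (simp add: circlepath_def has_contour_integral_part_circlepath_iff)
  then have "((\<lambda>t. \<i> * f (cis t)) has_integral \<i> * (2 * complex_of_real pi * f 0)) {0..2 * pi}"
    by (simp add: mult_ac)
  from has_integral_mult_right[OF this, of "- \<i>"] show ?thesis
    by (simp add: mult.assoc[symmetric])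
qed

lemma mv_holomorphic_on_translate:
  assumes "mv_holomorphic_on F ((+) x ` S)"
  shows "mv_holomorphic_on (\<lambda>z. F (x + z)) S"
  unfolding mv_holomorphic_on_def
proof
  fix z assume "z \<in> S"
  then obtain D where D: "(F has_derivative D) (at (x + z))" "\<And>c v. D (c *s v) = c * D v"
    using assms by (auto simp: mv_holomorphic_on_def)
  have "((\<lambda>z. F (x + z)) has_derivative D) (at z)"
    by (rule has_derivative_compose[of "\<lambda>z. x + z" "\<lambda>h. h" z UNIV F D, simplified])
       (use D(1) in \<open>auto intro!: derivative_eq_intros\<close>)
  then show "\<exists>D. ((\<lambda>z. F (x + z)) has_derivative D) (at z) \<and> (\<forall>c v. D (c *s v) = c * D v)"
    using D(2) by blast
qed

lemma mv_holomorphic_on_line: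
  assumes "mv_holomorphic_on F S" and "\<And>c. c \<in> U \<Longrightarrow> c *s z \<in> S"
  shows "(\<lambda>c. F (c *s z)) holomorphic_on U"
  unfolding holomorphic_on_def
proof
  fix c assume "c \<in> U"
  then obtain D where D: "(F has_derivative D) (at (c *s z))" "\<And>c v. D (c *s v) = c * D v"
    using assms unfolding mv_holomorphic_on_def by blast
  have "((\<lambda>c. c *s z) has_derivative (\<lambda>h. h *s z)) (at c)"
    using bounded_linear_vector_scalar_mult_left by (rule bounded_linear_imp_has_derivative)
  from has_derivative_compose[OF this D(1)]
  have "((\<lambda>c. F (c *s z)) has_field_derivative D z) (at c)"
    by (simp add: has_field_derivative_def D(2) mult_commute_abs)
  then show "(\<lambda>c. F (c *s z)) field_differentiable at c within U"
    using field_differentiable_at_within field_differentiable_def by blast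
qed

lemma mv_holomorphic_on_imp_continuous_on:
  "mv_holomorphic_on F S \<Longrightarrow> continuous_on S F"
  unfolding mv_holomorphic_on_def
  by (meson continuous_at_imp_continuous_on has_derivative_continuous)

text \<open>Pointwise \<open>|f|^2 >= (Re f)^2 >= 2 Re f - 1\<close>, and the right-hand side has
  mean \<open>2 Re (f 0) - 1 = 1\<close> over the circle.\<close>

lemma holomorphic_circle_mean_norm_square:
  assumes hol: "f holomorphic_on cball 0 1" and f0: "f 0 = 1"
  shows "ennreal (2 * pi) \<le> (\<integral>\<^sup>+t\<in>{0..2 * pi}. ennreal ((norm (f (cis t)))\<^sup>2) \<partial>lborel)"
proof -
  define g where "g t = (norm (f (cis t)))\<^sup>2" for t
  have "continuous_on {0..2 * pi} (\<lambda>t. f (cis t))"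
    by (rule continuous_on_compose2[OF holomorphic_on_imp_continuous_on[OF hol]])
       (auto intro!: continuous_intros)
  then have "continuous_on {0..2 * pi} g"
    unfolding g_def by (intro continuous_intros)
  then have int: "set_integrable lborel {0..2 * pi} g"
    by (rule borel_integrable_atLeastAtMost')
  have "((\<lambda>t. f (cis t)) has_integral complex_of_real (2 * pi)) {0..2 * pi}"
    using holomorphic_circle_mean[OF hol] f0 by simp
  then have "((\<lambda>t. Re (f (cis t))) has_integral Re (complex_of_real (2 * pi))) {0..2 * pi}"
    by (rule has_integral_Re)
  then have "((\<lambda>t. Re (f (cis t))) has_integral 2 * pi) {0..2 * pi}"
    by simp
  then have "((\<lambda>t. 2 * Re (f (cis t)) - 1) has_integral 2 * (2 * pi) - (2 * pi - 0)) {0..2 * pi}"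
    by (intro has_integral_diff has_integral_mult_right) (use has_integral_const_real[of "1::real" 0 "2 * pi"] in auto)
  moreover have "(g has_integral integral {0..2 * pi} g) {0..2 * pi}"
    using set_borel_integral_eq_integral(1)[OF int] by blast
  moreover have "2 * Re (f (cis t)) - 1 \<le> g t" for t
  proof -
    have "(Re (f (cis t)))\<^sup>2 \<le> g t"
      by (simp add: g_def cmod_power2)
    moreover have "0 \<le> (Re (f (cis t)) - 1)\<^sup>2" by simp
    ultimately show ?thesis by (simp add: power2_eq_square algebra_simps)
  qed
  ultimately have "2 * (2 * pi) - (2 * pi - 0) \<le> integral {0..2 * pi} g"
    by (rule has_integral_le)
  then have "2 * pi \<le> (LINT t : {0..2 * pi} | lborel. g t)"
    using set_borel_integral_eq_integral(2)[OF int] by simp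
  then have "ennreal (2 * pi) \<le> ennreal (LINT t | lborel. indicator {0..2 * pi} t *\<^sub>R g t)"
    by (intro ennreal_leI) (simp add: set_lebesgue_integral_def)
  also have "\<dots> = (\<integral>\<^sup>+t. ennreal (indicator {0..2 * pi} t *\<^sub>R g t) \<partial>lborel)"
    using int by (intro nn_integral_eq_integral[symmetric]) (auto simp: set_integrable_def g_def)
  also have "\<dots> = (\<integral>\<^sup>+t\<in>{0..2 * pi}. ennreal (g t) \<partial>lborel)"
    by (intro nn_integral_cong) (simp add: indicator_def)
  finally show ?thesis by (simp add: g_def)
qed

text \<open>An abstraction of the squared length \<open>|w|^2\<close> of the linear coordinate
  attached to a positive definite hermitian form. The measure-theoretic arguments use its
  homogeneity and positivity instead of the matrix entries.\<close>

locale hermitian_gauge =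
  fixes Q :: "complex^'n \<Rightarrow> real"
  assumes continuous_Q: "continuous_on UNIV Q"
    and Q_scale: "Q (c *s z) = (cmod c)\<^sup>2 * Q z"
    and Q_pos: "z \<noteq> 0 \<Longrightarrow> 0 < Q z"
begin

lemma Q_zero [simp]: "Q 0 = 0"
  using Q_scale[of 0 0] by simp

lemma Q_nonneg: "0 \<le> Q z"
  by (cases "z = 0") (auto dest: Q_pos)

lemma Q_scaleR: "Q (r *\<^sub>R z) = r\<^sup>2 * Q z"
  by (simp add: scaleR_eq_scalar_mult Q_scale)

lemma Q_measurable [measurable]: "Q \<in> borel_measurable borel"
  using continuous_Q by (rule borel_measurable_continuous_onI)

lemma open_Q_less: "open {z. Q z < r}"
  using continuous_Q by (intro open_Collect_less) (auto simp: continuous_on_const)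

text \<open>The constant is the minimum of \<open>Q\<close> over the unit sphere, carried to all
  vectors by homogeneity.\<close>

lemma Q_ge_norm_square: "\<exists>m>0. \<forall>z. m * (norm z)\<^sup>2 \<le> Q z"
proof -
  have "sphere (0 :: complex^'n) 1 \<noteq> {}" by simp
  then obtain y where y: "y \<in> sphere 0 1" "\<And>z. z \<in> sphere 0 1 \<Longrightarrow> Q y \<le> Q z"
    using continuous_attains_inf[of "sphere 0 1" Q] continuous_Q
    by (metis compact_sphere continuous_on_subset subset_UNIV)
  have "Q y * (norm z)\<^sup>2 \<le> Q z" for z
  proof (cases "z = 0")
    case False
    have "Q y \<le> Q ((1 / norm z) *\<^sub>R z)"
      using False by (intro y(2)) simp
    then show ?thesis using False by (simp add: Q_scaleR field_simps)
  qed simp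
  moreover have "Q y > 0" using y(1) by (intro Q_pos) auto
  ultimately show ?thesis by blast
qed

lemma compact_Q_le: "compact {z. Q z \<le> r}"
proof -
  obtain m where m: "m > 0" "\<And>z. m * (norm z)\<^sup>2 \<le> Q z"
    using Q_ge_norm_square by blast
  have "norm z \<le> sqrt (r / m)" if "Q z \<le> r" for z
    using m(1) m(2)[of z] that by (intro real_le_rsqrt) (simp add: field_simps)
  then have "bounded {z. Q z \<le> r}"
    unfolding bounded_iff by blast
  moreover have "closed {z. Q z \<le> r}"
    using continuous_Q by (intro closed_Collect_le) (auto simp: continuous_on_const)
  ultimately show ?thesis by (simp add: compact_eq_bounded_closed)
qed

definition V :: real where "V = measure lborel {z. Q z < 1}"

lemma emeasure_Q_less_1: "emeasure lborel {z. Q z < 1} = ennreal V"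
proof -
  have "emeasure lborel {z. Q z < 1} \<le> emeasure lborel {z. Q z \<le> 1}"
    by (intro emeasure_mono) auto
  also have "\<dots> < \<infinity>"
    using compact_Q_le by (rule emeasure_compact_finite)
  finally show ?thesis
    unfolding V_def by (intro emeasure_eq_ennreal_measure) auto
qed

lemma V_pos: "0 < V"
proof -
  have "{z. Q z < 1} \<notin> null_sets lborel"
  proof
    assume "{z. Q z < 1} \<in> null_sets lborel"
    then have "negligible {z. Q z < 1}"
      using null_sets_completionI negligible_iff_null_sets by blast
    then have "{z. Q z < 1} = {}"
      using open_Q_less open_not_negligible by blast
    then show False using Q_zero by (metis (mono_tags) empty_iff mem_Collect_eq zero_less_one)
  qed
  then show ?thesis
    using emeasure_Q_less_1 by (auto simp: null_sets_def V_def zero_less_measure_iff)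
qed

text \<open>The real dimension is \<open>2n\<close>, so dilation by the \<open>2n\<close>-th root of
  \<open>r\<close> multiplies volumes by \<open>r\<close>. In terms of \<open>Q ^ n\<close> the
  volume of sublevel sets is therefore linear, which is what the layer cake formula exploits
  below.\<close>

lemma emeasure_Q_power_less:
  assumes "0 < r"
  shows "emeasure lborel {z. Q z ^ CARD('n) < r} = ennreal (r * V)"
proof -
  define s where "s = root (2 * CARD('n)) r"
  have s: "s > 0" "s ^ (2 * CARD('n)) = r"
    using assms by (auto simp: s_def)
  have "Q (s *\<^sub>R z) ^ CARD('n) < r \<longleftrightarrow> Q z < 1" for z
  proof -
    have "Q (s *\<^sub>R z) ^ CARD('n) = r * Q z ^ CARD('n)"
      using s(2) by (simp add: Q_scaleR power_mult_distrib power_mult)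
    then have "Q (s *\<^sub>R z) ^ CARD('n) < r \<longleftrightarrow> Q z ^ CARD('n) < 1"
      using assms by simp
    also have "\<dots> \<longleftrightarrow> Q z < 1"
      using Q_nonneg[of z] by (simp add: power_less_one_iff)
    finally show ?thesis .
  qed
  then have "emeasure lborel {z. Q z ^ CARD('n) < r} = ennreal (s ^ DIM(complex^'n)) * emeasure lborel {z. Q z < 1}"
    using nn_integral_lborel_scaleR[of "indicator {z. Q z ^ CARD('n) < r}" s] s(1)
    by (simp add: nn_integral_indicator[symmetric] indicator_def del: nn_integral_indicator)
  also have "\<dots> = ennreal (r * V)"
    using s(2) assms by (simp add: emeasure_Q_less_1 ennreal_mult' mult.commute[of "CARD('n)"] )
  finally show ?thesis .
qed

text \<open>By rotation invariance the weighted integral of $|H|^2$ can be averaged over the circles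
  $e^{it}z$ first.\<close>

lemma nn_integral_norm_square_ge:
  assumes H: "mv_holomorphic_on H {z. Q z < 1}" and H0: "H 0 = 1"
    and [measurable]: "k \<in> borel_measurable borel" and k: "\<And>t z. k (cis t *s z) = k z"
  shows "(\<integral>\<^sup>+z\<in>{z. Q z < 1}. k z \<partial>lborel)
    \<le> (\<integral>\<^sup>+z\<in>{z. Q z < 1}. ennreal ((norm (H z))\<^sup>2) * k z \<partial>lborel)"
proof -
  \<comment> \<open>Extending \<open>H\<close> by zero before taking the norm makes the integrand
    Borel on the whole space.\<close>
  define h where "h z = ennreal ((norm (indicator {z. Q z < 1} z *\<^sub>R H z))\<^sup>2)" for z
  have "(\<lambda>z. indicator {z. Q z < 1} z *\<^sub>R H z) \<in> borel_measurable borel"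
    by (intro borel_measurable_continuous_on_indicator mv_holomorphic_on_imp_continuous_on H
        borel_open open_Q_less)
  then have [measurable]: "h \<in> borel_measurable borel"
    unfolding h_def by measurable
  have h_eq: "h z = ennreal ((norm (H z))\<^sup>2) * indicator {z. Q z < 1} z" for z
    by (simp add: h_def indicator_def)
  have [measurable]: "(\<lambda>(t, z :: complex^'n). cis t *s z) \<in> borel_measurable (borel \<Otimes>\<^sub>M borel)"
  proof -
    have "continuous_on UNIV (\<lambda>p :: real \<times> (complex^'n). cis (fst p) *s snd p)"
      unfolding vector_scalar_mult_def by (intro continuous_intros)
    then have "(\<lambda>p :: real \<times> (complex^'n). cis (fst p) *s snd p) \<in> borel_measurable borel"
      by (rule borel_measurable_continuous_onI)
    then show ?thesis by (simp add: borel_prod case_prod_beta')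
  qed
  \<comment> \<open>For \<open>z\<close> in the ellipsoid the whole disc of multiples
    \<open>c *s z\<close> with \<open>cmod c \<le> 1\<close> stays in it, so
    \<open>c \<mapsto> H (c *s z)\<close> is holomorphic on the closed disc with value 1 at the
    centre.\<close>
  have circ: "ennreal (2 * pi) * indicator {z. Q z < 1} z
    \<le> (\<integral>\<^sup>+t. h (cis t *s z) * indicator {0..2 * pi} t \<partial>lborel)" for z
  proof (cases "Q z < 1")
    case True
    have sub: "c *s z \<in> {z. Q z < 1}" if "c \<in> cball 0 1" for c
    proof -
      have "(cmod c)\<^sup>2 * Q z \<le> 1 * Q z"
        using that Q_nonneg by (intro mult_right_mono) (auto simp: power_le_one_iff)
      then show ?thesis using True by (simp add: Q_scale)
    qed
    have "(\<lambda>c. H (c *s z)) holomorphic_on cball 0 1"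
      using sub by (rule mv_holomorphic_on_line[OF H])
    from holomorphic_circle_mean_norm_square[OF this] show ?thesis
      using True by (simp add: H0 h_eq Q_scale)
  qed simp
  have "ennreal (2 * pi) * (\<integral>\<^sup>+z\<in>{z. Q z < 1}. k z \<partial>lborel)
      = (\<integral>\<^sup>+z. k z * (ennreal (2 * pi) * indicator {z. Q z < 1} z) \<partial>lborel)"
    by (subst nn_integral_cmult[symmetric]) (auto simp: mult_ac)
  also have "\<dots> \<le> (\<integral>\<^sup>+z. k z * (\<integral>\<^sup>+t. h (cis t *s z) * indicator {0..2 * pi} t \<partial>lborel) \<partial>lborel)"
    by (intro nn_integral_mono mult_left_mono circ) auto
  also have "\<dots> = (\<integral>\<^sup>+z. (\<integral>\<^sup>+t. k z * (h (cis t *s z) * indicator {0..2 * pi} t) \<partial>lborel) \<partial>lborel)"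
    by (intro nn_integral_cong nn_integral_cmult[symmetric]) measurable
  also have "\<dots> = (\<integral>\<^sup>+t. (\<integral>\<^sup>+z. k z * (h (cis t *s z) * indicator {0..2 * pi} t) \<partial>lborel) \<partial>lborel)"
    by (rule lborel_pair.Fubini') measurable
  \<comment> \<open>Invariance of \<open>k\<close> turns the integrand into one function evaluated
    at the rotated point; rotation invariance of the measure then removes \<open>t\<close> from the
    inner integral.\<close>
  also have "\<dots> = (\<integral>\<^sup>+t. (\<integral>\<^sup>+z. (h (cis t *s z) * k (cis t *s z)) * indicator {0..2 * pi} t \<partial>lborel) \<partial>lborel)"
    by (simp add: k mult_ac)
  also have "\<dots> = (\<integral>\<^sup>+t. (\<integral>\<^sup>+z. h (cis t *s z) * k (cis t *s z) \<partial>lborel) * indicator {0..2 * pi} t \<partial>lborel)"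
    by (intro nn_integral_cong nn_integral_multc) measurable
  also have "\<dots> = (\<integral>\<^sup>+t. (\<integral>\<^sup>+z. h z * k z \<partial>lborel) * indicator {0..2 * pi} (t::real) \<partial>lborel)"
    by (subst nn_integral_lborel_rotate[of "\<lambda>z. h z * k z"]) auto
  also have "\<dots> = ennreal (2 * pi) * (\<integral>\<^sup>+z. h z * k z \<partial>lborel)"
    by (subst nn_integral_cmult) (auto simp: mult.commute)
  finally have "(\<integral>\<^sup>+z\<in>{z. Q z < 1}. k z \<partial>lborel) \<le> (\<integral>\<^sup>+z. h z * k z \<partial>lborel)"
    by (subst (asm) ennreal_mult_le_mult_iff) auto
  then show ?thesis
    by (simp add: h_eq mult_ac)
qed

end

section \<open>An approximate identity\<close>

text \<open>The layer cake formula: \<open>s / (s + (1 - s) \<rho>)\<^sup>2\<close> is decreasing in \<open>\<rho>\<close> with derivative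
  \<open>- 2 s (1 - s) / (s + (1 - s) \<rho>)\<^sup>3\<close>, and \<open>(1 - s) \<sigma>\<^sup>2 / (s + (1 - s) \<sigma>)\<^sup>2\<close> is an antiderivative of
  \<open>\<sigma>\<close> times the absolute value of this derivative.\<close>

lemma nn_integral_kernel_le:
  fixes f :: "'a::euclidean_space \<Rightarrow> ennreal" and \<rho> :: "'a \<Rightarrow> real"
  assumes [measurable]: "f \<in> borel_measurable borel" "\<rho> \<in> borel_measurable borel"
    and \<rho>: "\<And>z. 0 \<le> \<rho> z" and r: "0 < r" "r \<le> 1" and s: "0 < s" "s < 1" and v: "0 \<le> v"
    and C: "\<And>\<sigma>. 0 < \<sigma> \<Longrightarrow> \<sigma> \<le> r \<Longrightarrow> (\<integral>\<^sup>+z\<in>{z. \<rho> z < \<sigma>}. f z \<partial>lborel) \<le> C * ennreal (\<sigma> * v)"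
  shows "(\<integral>\<^sup>+z\<in>{z. \<rho> z < r}. ennreal (s / (s + (1 - s) * \<rho> z)\<^sup>2) * f z \<partial>lborel) \<le> C * ennreal v"
proof -
  define K where "K t = s / (s + (1 - s) * t)\<^sup>2" for t
  define k where "k t = 2 * s * (1 - s) / (s + (1 - s) * t) ^ 3" for t
  define \<Phi> where "\<Phi> t = (1 - s) * t\<^sup>2 / (s + (1 - s) * t)\<^sup>2" for t
  have pos: "s + (1 - s) * t > 0" if "t \<ge> 0" for t
    using s that by (simp add: add_pos_nonneg)
  have k_nonneg: "k t \<ge> 0" if "t \<ge> 0" for t
    using s pos[OF that] by (simp add: k_def)
  have [measurable]: "k \<in> borel_measurable borel"
    unfolding k_def by measurable
  have [measurable]: "(\<lambda>(z, \<sigma>). indicator {\<rho> z<..r} \<sigma> :: ennreal) \<in> borel_measurable (borel \<Otimes>\<^sub>M borel)"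
  proof -
    have "(\<lambda>(z, \<sigma>). indicator {\<rho> z<..r} \<sigma> :: ennreal) = (\<lambda>(z, \<sigma>). if \<rho> z < \<sigma> \<and> \<sigma> \<le> r then 1 else 0)"
      by (auto simp: indicator_def fun_eq_iff)
    then show ?thesis by simp
  qed
  have K_deriv: "((\<lambda>t. - K t) has_real_derivative k t) (at t)" if "t \<ge> 0" for t
    unfolding K_def k_def using pos[OF that]
    by (auto intro!: derivative_eq_intros simp: power2_eq_square power3_eq_cube divide_simps)
  have \<Phi>_deriv: "(\<Phi> has_real_derivative t * k t) (at t)" if "t \<ge> 0" for t
    unfolding \<Phi>_def k_def using pos[OF that]
    by (auto intro!: derivative_eq_intros simp: power2_eq_square power3_eq_cube divide_simps)
       (auto simp: algebra_simps)
  \<comment> \<open>The kernel is written as its value at the cutoff \<open>r\<close> plus the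
    integral of \<open>k = - K'\<close>. The interval is open at \<open>t\<close> so that after
    exchanging integrals the inner set is the strict sublevel set to which \<open>C\<close> applies;
    the endpoint is a null set.\<close>
  have K_eq: "ennreal (K t) = ennreal (K r) + (\<integral>\<^sup>+\<sigma>. ennreal (k \<sigma>) * indicator {t<..r} \<sigma> \<partial>lborel)"
    if t: "0 \<le> t" "t \<le> r" for t
  proof -
    have "(\<integral>\<^sup>+\<sigma>. ennreal (k \<sigma>) * indicator {t<..r} \<sigma> \<partial>lborel)
        = (\<integral>\<^sup>+\<sigma>. ennreal (k \<sigma>) * indicator {t..r} \<sigma> \<partial>lborel)"
      by (intro nn_integral_cong_AE, use AE_lborel_singleton[of t] in eventually_elim)
         (auto simp: indicator_def)
    also have "\<dots> = ennreal (- K r - (- K t))"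
      by (intro nn_integral_FTC_Icc) (use t K_deriv k_nonneg in \<open>auto intro: has_field_derivative_at_within\<close>)
    finally have *: "(\<integral>\<^sup>+\<sigma>. ennreal (k \<sigma>) * indicator {t<..r} \<sigma> \<partial>lborel) = ennreal (K t - K r)"
      by simp
    have "K r \<le> K t"
      unfolding K_def using s t r pos[of t] pos[of r] by (intro divide_left_mono power_mono add_left_mono mult_left_mono) auto
    moreover have "0 \<le> K r" using s by (simp add: K_def)
    ultimately show ?thesis
      unfolding * by (subst ennreal_plus[symmetric]) auto
  qed
  have "(\<integral>\<^sup>+z\<in>{z. \<rho> z < r}. ennreal (K (\<rho> z)) * f z \<partial>lborel)
      = (\<integral>\<^sup>+z. ennreal (K r) * (f z * indicator {z. \<rho> z < r} z)
          + (\<integral>\<^sup>+\<sigma>. ennreal (k \<sigma>) * indicator {\<rho> z<..r} \<sigma> * (f z * indicator {z. \<rho> z < r} z) \<partial>lborel) \<partial>lborel)"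
  proof (rule nn_integral_cong)
    fix z
    have "(\<integral>\<^sup>+\<sigma>. ennreal (k \<sigma>) * indicator {\<rho> z<..r} \<sigma> * (f z * indicator {z. \<rho> z < r} z) \<partial>lborel)
      = (\<integral>\<^sup>+\<sigma>. ennreal (k \<sigma>) * indicator {\<rho> z<..r} \<sigma> \<partial>lborel) * (f z * indicator {z. \<rho> z < r} z)"
      by (intro nn_integral_multc) measurable
    then show "ennreal (K (\<rho> z)) * f z * indicator {z. \<rho> z < r} z = ennreal (K r) * (f z * indicator {z. \<rho> z < r} z)
          + (\<integral>\<^sup>+\<sigma>. ennreal (k \<sigma>) * indicator {\<rho> z<..r} \<sigma> * (f z * indicator {z. \<rho> z < r} z) \<partial>lborel)"
      using K_eq[of "\<rho> z"] \<rho>[of z] by (auto simp: indicator_def distrib_right)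
  qed
  also have "\<dots> = ennreal (K r) * (\<integral>\<^sup>+z\<in>{z. \<rho> z < r}. f z \<partial>lborel)
      + (\<integral>\<^sup>+z. (\<integral>\<^sup>+\<sigma>. ennreal (k \<sigma>) * indicator {\<rho> z<..r} \<sigma> * (f z * indicator {z. \<rho> z < r} z) \<partial>lborel) \<partial>lborel)"
    by (subst nn_integral_add) (auto simp: nn_integral_cmult)
  also have "(\<integral>\<^sup>+z. (\<integral>\<^sup>+\<sigma>. ennreal (k \<sigma>) * indicator {\<rho> z<..r} \<sigma> * (f z * indicator {z. \<rho> z < r} z) \<partial>lborel) \<partial>lborel)
      = (\<integral>\<^sup>+\<sigma>. (\<integral>\<^sup>+z. ennreal (k \<sigma>) * indicator {\<rho> z<..r} \<sigma> * (f z * indicator {z. \<rho> z < r} z) \<partial>lborel) \<partial>lborel)"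
    by (rule lborel_pair.Fubini') measurable
  also have "\<dots> \<le> (\<integral>\<^sup>+\<sigma>. C * ennreal v * (ennreal (\<sigma> * k \<sigma>) * indicator {0..r} \<sigma>) \<partial>lborel)"
  proof (rule nn_integral_mono)
    fix \<sigma>
    show "(\<integral>\<^sup>+z. ennreal (k \<sigma>) * indicator {\<rho> z<..r} \<sigma> * (f z * indicator {z. \<rho> z < r} z) \<partial>lborel)
        \<le> C * ennreal v * (ennreal (\<sigma> * k \<sigma>) * indicator {0..r} \<sigma>)"
    proof (cases "0 < \<sigma> \<and> \<sigma> \<le> r")
      case True
      have "(\<integral>\<^sup>+z. ennreal (k \<sigma>) * indicator {\<rho> z<..r} \<sigma> * (f z * indicator {z. \<rho> z < r} z) \<partial>lborel)
          = ennreal (k \<sigma>) * (\<integral>\<^sup>+z\<in>{z. \<rho> z < \<sigma>}. f z \<partial>lborel)"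
        by (subst nn_integral_cmult[symmetric])
           (use True in \<open>auto intro!: nn_integral_cong simp: indicator_def\<close>)
      also have "\<dots> \<le> ennreal (k \<sigma>) * (C * ennreal (\<sigma> * v))"
        using C True by (intro mult_left_mono) auto
      also have "\<dots> = C * ennreal v * (ennreal (\<sigma> * k \<sigma>) * indicator {0..r} \<sigma>)"
        using True v k_nonneg[of \<sigma>] by (simp add: ennreal_mult mult_ac)
      finally show ?thesis .
    next
      case False
      then have "indicator {\<rho> z<..r} \<sigma> = (0 :: ennreal)" for z
        using \<rho>[of z] by (auto simp: indicator_def)
      then show ?thesis by simp
    qed
  qed
  also have "\<dots> = C * ennreal v * (\<integral>\<^sup>+\<sigma>\<in>{0..r}. ennreal (\<sigma> * k \<sigma>) \<partial>lborel)"
    by (intro nn_integral_cmult) measurable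
  also have "(\<integral>\<^sup>+\<sigma>\<in>{0..r}. ennreal (\<sigma> * k \<sigma>) \<partial>lborel) = ennreal (\<Phi> r - \<Phi> 0)"
    by (intro nn_integral_FTC_Icc) (use r \<Phi>_deriv k_nonneg in \<open>auto intro: has_field_derivative_at_within\<close>)
  also have "\<Phi> r - \<Phi> 0 = \<Phi> r" by (simp add: \<Phi>_def)
  also have "ennreal (K r) * (\<integral>\<^sup>+z\<in>{z. \<rho> z < r}. f z \<partial>lborel) + C * ennreal v * ennreal (\<Phi> r)
      \<le> ennreal (K r) * (C * ennreal (r * v)) + C * ennreal v * ennreal (\<Phi> r)"
    using C[of r] r by (intro add_right_mono mult_left_mono) auto
  also have "\<dots> = C * ennreal v * ennreal (r * K r + \<Phi> r)"
  proof -
    have "0 \<le> K r" "0 \<le> \<Phi> r" using s by (auto simp: K_def \<Phi>_def)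
    then show ?thesis using r v by (simp add: ennreal_mult ennreal_plus distrib_left mult_ac)
  qed
  \<comment> \<open>The boundary term and the integral add up to
    \<open>r (s + (1 - s) r) / (s + (1 - s) r)^2\<close>. The resulting quotient is at most 1
    because \<open>s r \<le> s\<close>.\<close>
  also have "r * K r + \<Phi> r = r / (s + (1 - s) * r)"
    using pos[of r] r by (simp add: K_def \<Phi>_def divide_simps power2_eq_square) (auto simp: algebra_simps)
  also have "C * ennreal v * ennreal (r / (s + (1 - s) * r)) \<le> C * ennreal v * 1"
  proof -
    have "s * r \<le> s * 1" using r s by (intro mult_left_mono) auto
    then have "r / (s + (1 - s) * r) \<le> 1"
      using pos[of r] r by (simp add: algebra_simps)
    then show ?thesis by (intro mult_left_mono) auto
  qed
  finally show ?thesis by (simp add: K_def add_mono)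
qed

context hermitian_gauge
begin

text \<open>Where \<open>Q ^ n < r\<close> the bound on averages passes to the kernel by the layer
  cake estimate. Where \<open>r \<le> Q ^ n\<close> the kernel tends to 0 uniformly with
  \<open>s\<close>, and the finite integral of \<open>f\<close> makes that contribution at most
  \<delta>.\<close>

lemma kernel_approximate_identity:
  assumes [measurable]: "f \<in> borel_measurable borel"
    and fin: "(\<integral>\<^sup>+z\<in>{z. Q z < 1}. f z \<partial>lborel) < \<infinity>"
    and r: "0 < r" "r \<le> 1"
    and C: "\<And>\<sigma>. 0 < \<sigma> \<Longrightarrow> \<sigma> \<le> r \<Longrightarrow>
      (\<integral>\<^sup>+z\<in>{z. Q z ^ CARD('n) < \<sigma>}. f z \<partial>lborel) \<le> C * emeasure lborel {z. Q z ^ CARD('n) < \<sigma>}"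
    and "\<delta> > 0"
  obtains s where "0 < s" "s < 1"
    "(\<integral>\<^sup>+z\<in>{z. Q z < 1}. ennreal (s / (s + (1 - s) * Q z ^ CARD('n))\<^sup>2) * f z \<partial>lborel)
      \<le> C * ennreal V + ennreal \<delta>"
proof -
  obtain i where i: "(\<integral>\<^sup>+z\<in>{z. Q z < 1}. f z \<partial>lborel) = ennreal i" "0 \<le> i"
    using fin by (metis ennreal_cases infinity_ennreal_def less_irrefl)
  \<comment> \<open>The bound \<open>1/2\<close> keeps \<open>1 - s\<close> at least
    \<open>1/2\<close>, whence the kernel is at most \<open>s / (r/2)^2 = 4 s / r^2\<close> away
    from the centre. The second bound makes this times \<open>i\<close> at most \<delta>;
    \<open>i + 1\<close> avoids division by zero.\<close>
  define s where "s = min (1/2) (\<delta> * r\<^sup>2 / (4 * (i + 1)))"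
  have s: "0 < s" "s \<le> 1/2"
    using \<open>\<delta> > 0\<close> r i(2) unfolding s_def by (simp, intro min.cobounded1)
  have "s \<le> \<delta> * r\<^sup>2 / (4 * (i + 1))" by (simp add: s_def)
  then have s_i: "4 * s / r\<^sup>2 * i \<le> \<delta>"
  proof -
    assume le: "s \<le> \<delta> * r\<^sup>2 / (4 * (i + 1))"
    have "4 * s / r\<^sup>2 * i \<le> 4 * s / r\<^sup>2 * (i + 1)"
      using s by (intro mult_left_mono) auto
    also have "\<dots> \<le> \<delta>" using le r i(2) by (simp add: field_simps)
    finally show ?thesis .
  qed
  define K where "K z = s / (s + (1 - s) * Q z ^ CARD('n))\<^sup>2" for z
  have K_le: "K z \<le> 4 * s / r\<^sup>2" if "r \<le> Q z ^ CARD('n)" for z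
  proof -
    have "r / 2 = 1/2 * r" by simp
    also have "\<dots> \<le> (1 - s) * Q z ^ CARD('n)"
      using s that r by (intro mult_mono) auto
    also have "\<dots> \<le> s + (1 - s) * Q z ^ CARD('n)" using s by simp
    finally have "K z \<le> s / (r / 2)\<^sup>2"
      unfolding K_def using s r by (intro divide_left_mono power_mono) auto
    then show ?thesis by (simp add: power_divide mult.commute)
  qed
  have [measurable]: "K \<in> borel_measurable borel" unfolding K_def by measurable
  have "(\<integral>\<^sup>+z\<in>{z. Q z < 1}. ennreal (K z) * f z \<partial>lborel)
      \<le> (\<integral>\<^sup>+z. ennreal (K z) * f z * indicator {z. Q z ^ CARD('n) < r} z
          + ennreal (4 * s / r\<^sup>2) * (f z * indicator {z. Q z < 1} z) \<partial>lborel)"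
  proof (rule nn_integral_mono)
    fix z
    show "ennreal (K z) * f z * indicator {z. Q z < 1} z
      \<le> ennreal (K z) * f z * indicator {z. Q z ^ CARD('n) < r} z
          + ennreal (4 * s / r\<^sup>2) * (f z * indicator {z. Q z < 1} z)"
    proof (cases "Q z ^ CARD('n) < r")
      case False
      then have "ennreal (K z) * f z \<le> ennreal (4 * s / r\<^sup>2) * f z"
        using K_le[of z] by (intro mult_right_mono ennreal_leI) auto
      with False show ?thesis by (auto simp: indicator_def)
    qed (auto simp: indicator_def)
  qed
  also have "\<dots> = (\<integral>\<^sup>+z\<in>{z. Q z ^ CARD('n) < r}. ennreal (K z) * f z \<partial>lborel)
      + ennreal (4 * s / r\<^sup>2) * (\<integral>\<^sup>+z\<in>{z. Q z < 1}. f z \<partial>lborel)"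
    by (subst nn_integral_add) (auto simp: nn_integral_cmult)
  also have "\<dots> \<le> C * ennreal V + ennreal \<delta>"
  proof (rule add_mono)
    show "(\<integral>\<^sup>+z\<in>{z. Q z ^ CARD('n) < r}. ennreal (K z) * f z \<partial>lborel) \<le> C * ennreal V"
      unfolding K_def
      by (rule nn_integral_kernel_le) (use r s V_pos C emeasure_Q_power_less Q_nonneg in auto)
    show "ennreal (4 * s / r\<^sup>2) * (\<integral>\<^sup>+z\<in>{z. Q z < 1}. f z \<partial>lborel) \<le> ennreal \<delta>"
      using s_i s i by (simp add: ennreal_mult'[symmetric] ennreal_leI)
  qed
  finally show ?thesis
    using that[of s] s by (simp add: K_def)
qed

text \<open>Otherwise the measure \<open>M\<close> with density \<open>1 / Q ^ n\<close> would be
  finite on the shrinking sets \<open>A i\<close>, hence \<open>M (A i)\<close> would tend to the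
  measure of their intersection, which is 0. But on \<open>A i\<close> the density exceeds
  \<open>(i + 1) / r\<close> off the origin while the volume is \<open>r V / (i + 1)\<close>, so
  \<open>M (A i)\<close> is never below \<open>V\<close>.\<close>

lemma nn_integral_inverse_Q_power:
  assumes "0 < r"
  shows "(\<integral>\<^sup>+z\<in>{z. Q z ^ CARD('n) < r}. ennreal (1 / Q z ^ CARD('n)) \<partial>lborel) = \<infinity>"
proof (rule ccontr)
  assume fin: "(\<integral>\<^sup>+z\<in>{z. Q z ^ CARD('n) < r}. ennreal (1 / Q z ^ CARD('n)) \<partial>lborel) \<noteq> \<infinity>"
  define M where "M = density lborel (\<lambda>z. ennreal (1 / Q z ^ CARD('n)))"
  define A where "A i = {z. Q z ^ CARD('n) < r / Suc i}" for i
  have [measurable]: "A i \<in> sets borel" for i unfolding A_def by measurable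
  have sub: "A i \<subseteq> {z. Q z ^ CARD('n) < r}" for i
  proof -
    have "r / Suc i \<le> r / 1" using assms by (intro divide_left_mono) auto
    then show ?thesis by (auto simp: A_def)
  qed
  have MA: "emeasure M (A i) = (\<integral>\<^sup>+z\<in>A i. ennreal (1 / Q z ^ CARD('n)) \<partial>lborel)" for i
    unfolding M_def by (intro emeasure_density) measurable
  have "emeasure M (A i) \<noteq> \<infinity>" for i
  proof -
    have "emeasure M (A i) \<le> (\<integral>\<^sup>+z\<in>{z. Q z ^ CARD('n) < r}. ennreal (1 / Q z ^ CARD('n)) \<partial>lborel)"
      unfolding MA using sub by (intro nn_integral_mono mult_left_mono) (auto simp: indicator_def)
    then show ?thesis using fin by (auto simp: top_unique)
  qed
  moreover have "decseq A"
  proof (rule decseq_SucI)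
    fix i
    have "r / Suc (Suc i) \<le> r / Suc i" using assms by (intro divide_left_mono) auto
    then show "A (Suc i) \<subseteq> A i" by (auto simp: A_def)
  qed
  moreover have "range A \<subseteq> sets M" by (auto simp: M_def)
  ultimately have "(\<lambda>i. emeasure M (A i)) \<longlonglongrightarrow> emeasure M (\<Inter>i. A i)"
    by (intro Lim_emeasure_decseq) auto
  moreover have "ennreal V \<le> emeasure M (A i)" for i
  proof -
    have "Suc i / r * (r / Suc i * V) = V" using assms by simp
    then have "ennreal V = ennreal (Suc i / r) * ennreal (r / Suc i * V)"
      using assms V_pos by (simp only: ennreal_mult'[symmetric] zero_le_divide_iff of_nat_0_le_iff less_imp_le simp_thms)
    also have "ennreal (r / Suc i * V) = emeasure lborel (A i)"
      using assms unfolding A_def by (intro emeasure_Q_power_less[symmetric]) simp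
    also have "ennreal (Suc i / r) * emeasure lborel (A i)
        = (\<integral>\<^sup>+z. ennreal (Suc i / r) * indicator (A i) z \<partial>lborel)"
      by (simp add: nn_integral_cmult)
    also have "\<dots> \<le> emeasure M (A i)"
      unfolding MA
    proof (rule nn_integral_mono_AE, use AE_lborel_singleton[of "0 :: complex^'n"] in eventually_elim)
      fix z :: "complex^'n" assume "z \<noteq> 0"
      then have "0 < Q z ^ CARD('n)" using Q_pos by simp
      then have "z \<in> A i \<Longrightarrow> Suc i / r \<le> 1 / Q z ^ CARD('n)"
        using assms by (simp add: A_def field_simps)
      then show "ennreal (Suc i / r) * indicator (A i) z \<le> ennreal (1 / Q z ^ CARD('n)) * indicator (A i) z"
        by (auto simp: indicator_def intro!: ennreal_leI)
    qed
    finally show ?thesis .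
  qed
  ultimately have "ennreal V \<le> emeasure M (\<Inter>i. A i)"
    by (intro LIMSEQ_le_const) auto
  moreover have "(\<Inter>i. A i) \<subseteq> {0}"
  proof (safe, rule ccontr)
    fix z assume z: "z \<in> (\<Inter>i. A i)" "z \<noteq> 0"
    then have "0 < Q z ^ CARD('n)" using Q_pos by simp
    then obtain i where "r / Q z ^ CARD('n) < real (Suc i)"
      using reals_Archimedean2 less_trans of_nat_less_iff lessI by metis
    then have "r / Suc i < Q z ^ CARD('n)"
      using \<open>0 < Q z ^ CARD('n)\<close> by (simp add: field_simps)
    then show False using z(1) by (auto simp: A_def dest!: spec[of _ i])
  qed
  then have "emeasure M (\<Inter>i. A i) \<le> emeasure M {0}"
    by (intro emeasure_mono) (auto simp: M_def)
  also have "emeasure M {0} = 0"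
    by (simp add: M_def emeasure_density)
  ultimately show False using V_pos by simp
qed

text \<open>If \<open>F 0\<close> were nonzero, \<open>|F|^2 f\<close> would be bounded below by a
  positive constant near 0, and the integral would dominate a multiple of the divergent integral of
  \<open>1 / Q ^ n\<close>.\<close>

lemma zero_of_weighted_integrable:
  assumes F: "continuous_on {z. Q z < 1} F"
    and c: "0 < c" "0 < r" "\<And>z. Q z < r \<Longrightarrow> ennreal c \<le> f z"
    and fin: "(\<integral>\<^sup>+z\<in>{z. Q z < 1}. ennreal ((norm (F z))\<^sup>2 / Q z ^ CARD('n)) * f z \<partial>lborel) < \<infinity>"
  shows "F 0 = 0"
proof (rule ccontr)
  assume F0: "F 0 \<noteq> 0"
  have "isCont F 0"
    using F open_Q_less by (metis (mono_tags) Q_zero continuous_on_eq_continuous_at mem_Collect_eq zero_less_one)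
  then obtain d where d: "d > 0" "\<And>z. norm z < d \<Longrightarrow> norm (F z - F 0) < norm (F 0) / 2"
    using F0 unfolding continuous_at_eps_delta by (metis dist_norm diff_zero half_gt_zero zero_less_norm_iff)
  obtain m where m: "m > 0" "\<And>z. m * (norm z)\<^sup>2 \<le> Q z"
    using Q_ge_norm_square by blast
  \<comment> \<open>The three bounds put \<open>Q z < r'\<close> inside the region where
    \<open>f\<close> is at least \<open>c\<close>, inside the ellipsoid, and inside the ball of
    radius \<open>d\<close> where \<open>F\<close> is close to \<open>F 0\<close>.\<close>
  define r' where "r' = min (min r 1) (m * d\<^sup>2)"
  have r': "0 < r'" "r' \<le> r" "r' \<le> 1" "r' \<le> m * d\<^sup>2" using c m d by (auto simp: r'_def)
  define e where "e = (norm (F 0) / 2)\<^sup>2"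
  have e: "0 < e" using F0 by (simp add: e_def)
  have low: "e \<le> (norm (F z))\<^sup>2" if "Q z < r'" for z
  proof -
    have "m * (norm z)\<^sup>2 < m * d\<^sup>2" using m(2)[of z] that r' by linarith
    then have "norm z < d" using m(1) d(1) by (simp add: power_less_imp_less_base)
    then have "norm (F z - F 0) < norm (F 0) / 2" by (rule d(2))
    then have "norm (F 0) / 2 \<le> norm (F z)" using norm_triangle_ineq2[of "F 0" "F z"] by (simp add: norm_minus_commute)
    then show ?thesis unfolding e_def by (intro power_mono) auto
  qed
  have Q_less: "Q z < r'" if "Q z ^ CARD('n) < r' ^ CARD('n)" for z
    using that r' Q_nonneg by (meson less_imp_le power_less_imp_less_base)
  have "ennreal (e * c) * (\<integral>\<^sup>+z\<in>{z. Q z ^ CARD('n) < r' ^ CARD('n)}. ennreal (1 / Q z ^ CARD('n)) \<partial>lborel)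
     = (\<integral>\<^sup>+z. ennreal (e * c) * (ennreal (1 / Q z ^ CARD('n)) * indicator {z. Q z ^ CARD('n) < r' ^ CARD('n)} z) \<partial>lborel)"
    by (intro nn_integral_cmult[symmetric]) measurable
  also have "\<dots> \<le> (\<integral>\<^sup>+z\<in>{z. Q z < 1}. ennreal ((norm (F z))\<^sup>2 / Q z ^ CARD('n)) * f z \<partial>lborel)"
  proof (rule nn_integral_mono)
    fix z
    show "ennreal (e * c) * (ennreal (1 / Q z ^ CARD('n)) * indicator {z. Q z ^ CARD('n) < r' ^ CARD('n)} z)
      \<le> ennreal ((norm (F z))\<^sup>2 / Q z ^ CARD('n)) * f z * indicator {z. Q z < 1} z"
    proof (cases "Q z ^ CARD('n) < r' ^ CARD('n)")
      case True
      then have z: "Q z < r'" by (rule Q_less)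
      have "ennreal (e * c) * ennreal (1 / Q z ^ CARD('n)) = ennreal (e / Q z ^ CARD('n)) * ennreal c"
        using e c Q_nonneg[of z] by (simp add: ennreal_mult'[symmetric] mult_ac)
      also have "\<dots> \<le> ennreal ((norm (F z))\<^sup>2 / Q z ^ CARD('n)) * f z"
        using z r' low[OF z] c(3)[of z] Q_nonneg[of z] by (intro mult_mono ennreal_leI divide_right_mono) auto
      finally show ?thesis using z r' by (simp add: indicator_def)
    qed simp
  qed
  finally show False
    using fin r' e c nn_integral_inverse_Q_power[of "r' ^ CARD('n)"]
    by (simp add: ennreal_mult_top)
qed

end

section \<open>From hermitian forms to the estimate for \<open>G\<close>\<close>

lemma norm_vec_square: "complex_of_real ((norm (z :: complex^'n))\<^sup>2) = (\<Sum>i\<in>UNIV. z $ i * cnj (z $ i))"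
proof -
  have "(norm z)\<^sup>2 = (\<Sum>i\<in>UNIV. (cmod (z $ i))\<^sup>2)"
    by (simp add: norm_vec_def L2_set_def sum_nonneg)
  then show ?thesis
    by (simp only: of_real_sum complex_norm_square)
qed

text \<open>Hence the length of the coordinate \<open>w\<close> depends on the form alone, whichever
  factor \<open>L\<close> is supplied.\<close>

lemma herm_form_eq_norm:
  assumes "A = L ** conj_transpose L"
  shows "herm_form A z = complex_of_real ((norm (z v* L))\<^sup>2)"
proof -
  have "herm_form A z = (\<Sum>i\<in>UNIV. \<Sum>j\<in>UNIV. \<Sum>k\<in>UNIV. (L $ i $ k * z $ i) * cnj (L $ j $ k * z $ j))"
    by (simp add: assms herm_form_def matrix_matrix_mult_def conj_transpose_def sum_distrib_left sum_distrib_right mult_ac)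
  also have "\<dots> = (\<Sum>i\<in>UNIV. \<Sum>k\<in>UNIV. \<Sum>j\<in>UNIV. (L $ i $ k * z $ i) * cnj (L $ j $ k * z $ j))"
    by (intro sum.cong refl sum.swap)
  also have "\<dots> = (\<Sum>k\<in>UNIV. \<Sum>i\<in>UNIV. \<Sum>j\<in>UNIV. (L $ i $ k * z $ i) * cnj (L $ j $ k * z $ j))"
    by (rule sum.swap)
  also have "\<dots> = complex_of_real ((norm (z v* L))\<^sup>2)"
    unfolding norm_vec_square by (simp add: vector_matrix_mult_def sum_product mult_ac)
  finally show ?thesis .
qed

lemma hermitian_gauge_herm_form:
  assumes "pos_def_hermitian A"
  shows "hermitian_gauge (\<lambda>z. Re (herm_form A z))"
proof
  show "continuous_on UNIV (\<lambda>z. Re (herm_form A z))"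
    unfolding herm_form_def by (intro continuous_intros)
  fix c :: complex and z :: "complex^'a"
  have "herm_form A (c *s z) = (c * cnj c) * herm_form A z"
    by (simp add: herm_form_def sum_distrib_left mult_ac)
  then show "Re (herm_form A (c *s z)) = (cmod c)\<^sup>2 * Re (herm_form A z)"
    by (simp add: complex_norm_square[symmetric] del: of_real_power)
qed (use assms in \<open>simp add: pos_def_hermitian_def\<close>)

lemma (in hermitian_gauge) scaleR_image_Q_less:
  assumes "0 < \<epsilon>"
  shows "(*\<^sub>R) \<epsilon> ` {z. Q z < 1} = {z. Q z < \<epsilon>\<^sup>2}"
proof (intro set_eqI iffI)
  fix z assume "z \<in> {z. Q z < \<epsilon>\<^sup>2}"
  then have "Q ((1 / \<epsilon>) *\<^sub>R z) < 1"
    using assms by (simp add: Q_scaleR field_simps)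
  moreover have "z = \<epsilon> *\<^sub>R ((1 / \<epsilon>) *\<^sub>R z)" using assms by simp
  ultimately show "z \<in> (*\<^sub>R) \<epsilon> ` {z. Q z < 1}" by blast
qed (use assms in \<open>auto simp: Q_scaleR\<close>)

lemma set_nn_integral_translate:
  fixes g :: "'a::euclidean_space \<Rightarrow> ennreal"
  shows "(\<integral>\<^sup>+y\<in>(+) x ` S. g y \<partial>lborel) = (\<integral>\<^sup>+z\<in>S. g (x + z) \<partial>lborel)"
proof -
  have "indicator ((+) x ` S) (x + z) = (indicator S z :: ennreal)" for z
    by (auto simp: indicator_def)
  then show ?thesis
    using nn_integral_lborel_translate[of "\<lambda>y. g y * indicator ((+) x ` S) y" x] by simp
qed

text \<open>Here \<open>f\<close> stands for \<open>exp_neg\<close> of \<phi> and \<open>e\<close>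
  for its value at \<open>x\<close>. One suitable \<theta> serves both purposes: the term with
  \<open>G\<close> gives the integral bound, and finiteness of the term with \<open>F\<close> gives
  the normalization \<open>G 0 = 1\<close>. The function is moved to the origin on the way.\<close>

lemma exists_extension:
  fixes A :: "complex^'n^'n" and f :: "complex^'n \<Rightarrow> ennreal" and e \<delta> :: real
  defines "Q \<equiv> \<lambda>z. Re (herm_form A z)"
  assumes A: "pos_def_hermitian A" and loc_int: "locally_nn_integrable_on f \<Omega>"
    and \<Omega>: "open \<Omega>" "(+) x ` {z. Q z \<le> 1} \<subseteq> \<Omega>"
    and limsup: "Limsup (at_right (0::real)) (\<lambda>\<epsilon>.
          (\<integral>\<^sup>+y \<in> (+) x ` (*\<^sub>R) \<epsilon> ` ellipsoid A. f y \<partial>lborel)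
            / emeasure lborel ((*\<^sub>R) \<epsilon> ` ellipsoid A)) \<le> ennreal e"
    and low: "0 < c" "\<forall>\<^sub>F y in nhds x. ennreal c \<le> f y"
    and e: "0 \<le> e" and \<delta>: "0 < \<delta>"
    and ext: "\<And>\<theta>. 0 < \<theta> \<Longrightarrow> \<theta> < pi / 2 \<Longrightarrow>
      \<exists>L :: complex^'n^'n. A = L ** conj_transpose L \<and>
        (\<exists>F G. mv_holomorphic_on F ((+) x ` ellipsoid A) \<and>
          mv_holomorphic_on G ((+) x ` ellipsoid A) \<and>
          (\<forall>y \<in> (+) x ` ellipsoid A. F y + G y = 1) \<and>
          ennreal (1 / (sin \<theta>)\<^sup>2) *
              (\<integral>\<^sup>+y \<in> (+) x ` ellipsoid A. ennreal ((norm (G y))\<^sup>2) * f y \<partial>lborel)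
            + ennreal (1 / (cos \<theta>)\<^sup>2) *
              (\<integral>\<^sup>+y \<in> (+) x ` ellipsoid A.
                ennreal ((norm (F y))\<^sup>2 / norm ((y - x) v* L) ^ (2 * CARD('n))) * f y
                \<partial>lborel)
            \<le> (\<integral>\<^sup>+y \<in> (+) x ` ellipsoid A.
                ennreal (1 / ((sin \<theta>)\<^sup>2 + norm ((y - x) v* L) ^ (2 * CARD('n)) * (cos \<theta>)\<^sup>2)\<^sup>2)
                  * f y \<partial>lborel))"
  obtains G where "mv_holomorphic_on G {z. Q z < 1}" "G 0 = 1"
    "(\<integral>\<^sup>+z\<in>{z. Q z < 1}. ennreal ((norm (G z))\<^sup>2) * f (x + z) \<partial>lborel)
      \<le> ennreal (e * measure lborel {z. Q z < 1} + \<delta>)"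
proof -
  interpret hermitian_gauge Q
    unfolding Q_def using A by (rule hermitian_gauge_herm_form)
  have E: "ellipsoid A = {z. Q z < 1}" by (simp add: ellipsoid_def Q_def)
  \<comment> \<open>Cutting \<open>f\<close> off outside \<Omega> gives a function that is Borel on
    the whole space and agrees with \<open>f\<close> on the closed translated ellipsoid.\<close>
  define g where "g y = f y * indicator \<Omega> y" for y
  have [measurable]: "g \<in> borel_measurable borel"
    using loc_int \<Omega>(1) unfolding locally_nn_integrable_on_def g_def
    by (subst (asm) borel_measurable_restrict_space_iff_ennreal) auto
  have [measurable]: "(\<lambda>z. g (x + z)) \<in> borel_measurable borel" by measurable
  have g_eq: "g (x + z) = f (x + z)" if "Q z \<le> 1" for z
    using that \<Omega>(2) by (auto simp: g_def indicator_def)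
  have fin: "(\<integral>\<^sup>+z\<in>{z. Q z < 1}. g (x + z) \<partial>lborel) < \<infinity>"
  proof -
    have "(\<integral>\<^sup>+z\<in>{z. Q z < 1}. g (x + z) \<partial>lborel) \<le> (\<integral>\<^sup>+z\<in>{z. Q z \<le> 1}. f (x + z) \<partial>lborel)"
      by (intro nn_integral_mono) (auto simp: indicator_def g_def)
    also have "\<dots> = (\<integral>\<^sup>+y\<in>(+) x ` {z. Q z \<le> 1}. f y \<partial>lborel)"
      by (rule set_nn_integral_translate[symmetric])
    also have "\<dots> < \<infinity>"
      using loc_int \<Omega>(2) compact_translation[OF compact_Q_le, of x 1]
      unfolding locally_nn_integrable_on_def by blast
    finally show ?thesis .
  qed
  \<comment> \<open>Half of the allowance \<delta> is spent on exceeding the limsup, since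
    \<open>C V = e V + \<delta> / 2\<close>; the other half is left for the approximate
    identity.\<close>
  define C where "C = e + \<delta> / (2 * V)"
  have C: "e < C" "0 \<le> C" using \<delta> V_pos e by (auto simp: C_def)
  have "\<forall>\<^sub>F \<epsilon> in at_right (0::real). (\<integral>\<^sup>+y \<in> (+) x ` (*\<^sub>R) \<epsilon> ` ellipsoid A. f y \<partial>lborel)
            / emeasure lborel ((*\<^sub>R) \<epsilon> ` ellipsoid A) < ennreal C"
    using limsup C e by (intro Limsup_lessD) (auto intro: le_less_trans ennreal_lessI)
  then obtain b where b: "b > 0" "\<And>\<epsilon>. 0 < \<epsilon> \<Longrightarrow> \<epsilon> < b \<Longrightarrow> (\<integral>\<^sup>+y \<in> (+) x ` (*\<^sub>R) \<epsilon> ` ellipsoid A. f y \<partial>lborel)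
            / emeasure lborel ((*\<^sub>R) \<epsilon> ` ellipsoid A) < ennreal C"
    unfolding eventually_at_right_field by auto
  \<comment> \<open>A level \<sigma> of \<open>Q ^ n\<close> corresponds to the dilation factor
    \<open>\<sigma>^(1 / (2n))\<close>; taking \<open>b / 2\<close> keeps this factor strictly below
    \<open>b\<close>.\<close>
  define r where "r = min 1 ((b / 2) ^ (2 * CARD('n)))"
  have r: "0 < r" "r \<le> 1" using b(1) by (auto simp: r_def)
  have avg: "(\<integral>\<^sup>+z\<in>{z. Q z ^ CARD('n) < \<sigma>}. g (x + z) \<partial>lborel)
      \<le> ennreal C * emeasure lborel {z. Q z ^ CARD('n) < \<sigma>}" if \<sigma>: "0 < \<sigma>" "\<sigma> \<le> r" for \<sigma>
  proof -
    define \<epsilon> where "\<epsilon> = root (2 * CARD('n)) \<sigma>"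
    have \<epsilon>: "\<epsilon> > 0" "\<epsilon> ^ (2 * CARD('n)) = \<sigma>" using \<sigma> by (auto simp: \<epsilon>_def)
    have "\<epsilon> ^ (2 * CARD('n)) \<le> (b / 2) ^ (2 * CARD('n))"
      unfolding \<epsilon>(2) using \<sigma>(2) by (simp add: r_def)
    then have "\<epsilon> \<le> b / 2" using b(1) \<epsilon>(1) by (subst (asm) power_mono_iff) auto
    then have "\<epsilon> < b" using b(1) by simp
    have "Q z ^ CARD('n) < \<sigma> \<longleftrightarrow> Q z < \<epsilon>\<^sup>2" for z
      using \<epsilon> Q_nonneg[of z] by (simp add: \<epsilon>(2)[symmetric] power_mult power_mono_iff not_le[symmetric])
    then have S: "{z. Q z ^ CARD('n) < \<sigma>} = (*\<^sub>R) \<epsilon> ` ellipsoid A"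
      unfolding E scaleR_image_Q_less[OF \<epsilon>(1)] by simp
    define m where "m = emeasure lborel ((*\<^sub>R) \<epsilon> ` ellipsoid A)"
    have m: "m = ennreal (\<sigma> * V)" using emeasure_Q_power_less[OF \<sigma>(1)] by (simp add: m_def S)
    have m0: "m \<noteq> 0" "m \<noteq> top" using V_pos \<sigma>(1) by (auto simp: m)
    have "(\<integral>\<^sup>+z\<in>{z. Q z ^ CARD('n) < \<sigma>}. g (x + z) \<partial>lborel) \<le> (\<integral>\<^sup>+z\<in>{z. Q z ^ CARD('n) < \<sigma>}. f (x + z) \<partial>lborel)"
      by (intro nn_integral_mono) (auto simp: indicator_def g_def)
    also have "\<dots> = (\<integral>\<^sup>+y \<in> (+) x ` (*\<^sub>R) \<epsilon> ` ellipsoid A. f y \<partial>lborel)"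
      unfolding S by (rule set_nn_integral_translate[symmetric])
    also have "\<dots> = (\<integral>\<^sup>+y \<in> (+) x ` (*\<^sub>R) \<epsilon> ` ellipsoid A. f y \<partial>lborel) / m * m"
      using m0 ennreal_divide_self[of m] by (simp add: ennreal_divide_times less_top[symmetric])
    also have "\<dots> \<le> ennreal C * m"
      using b(2)[OF \<epsilon>(1) \<open>\<epsilon> < b\<close>] unfolding m_def by (intro mult_right_mono) auto
    finally show ?thesis by (simp add: m_def S)
  qed
  obtain s where s: "0 < s" "s < 1" and s_le:
    "(\<integral>\<^sup>+z\<in>{z. Q z < 1}. ennreal (s / (s + (1 - s) * Q z ^ CARD('n))\<^sup>2) * g (x + z) \<partial>lborel)
      \<le> ennreal C * ennreal V + ennreal (\<delta> / 2)"
    by (rule kernel_approximate_identity[of "\<lambda>z. g (x + z)" r "ennreal C" "\<delta> / 2"])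
       (use fin r avg \<delta> in auto)
  \<comment> \<open>This is the angle with \<open>(sin \<theta>)^2 = s\<close>, so the right-hand
    side of the hypothesis, multiplied by \<open>s\<close>, is the integral against the
    kernel.\<close>
  define \<theta> where "\<theta> = arcsin (sqrt s)"
  have "0 \<le> sqrt s" "sqrt s \<le> 1" using s by simp_all
  then have "-1 \<le> sqrt s" by linarith
  then have sin: "(sin \<theta>)\<^sup>2 = s"
    using s \<open>sqrt s \<le> 1\<close> by (simp add: \<theta>_def)
  have cos: "(cos \<theta>)\<^sup>2 = 1 - s"
    using sin by (simp add: cos_squared_eq)
  have \<theta>: "0 < \<theta>" "\<theta> < pi / 2"
  proof -
    have "0 < sqrt s" "sqrt s < 1" using s by auto
    then show "0 < \<theta>" "\<theta> < pi / 2"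
      unfolding \<theta>_def using \<open>-1 \<le> sqrt s\<close> arcsin_less_arcsin[of 0 "sqrt s"] arcsin_less_arcsin[of "sqrt s" 1] by auto
  qed
  obtain L :: "complex^'n^'n" and F G where L: "A = L ** conj_transpose L"
    and F: "mv_holomorphic_on F ((+) x ` ellipsoid A)"
    and G: "mv_holomorphic_on G ((+) x ` ellipsoid A)"
    and FG: "\<And>y. y \<in> (+) x ` ellipsoid A \<Longrightarrow> F y + G y = 1"
    and le: "ennreal (1 / (sin \<theta>)\<^sup>2) *
              (\<integral>\<^sup>+y \<in> (+) x ` ellipsoid A. ennreal ((norm (G y))\<^sup>2) * f y \<partial>lborel)
            + ennreal (1 / (cos \<theta>)\<^sup>2) *
              (\<integral>\<^sup>+y \<in> (+) x ` ellipsoid A.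
                ennreal ((norm (F y))\<^sup>2 / norm ((y - x) v* L) ^ (2 * CARD('n))) * f y
                \<partial>lborel)
            \<le> (\<integral>\<^sup>+y \<in> (+) x ` ellipsoid A.
                ennreal (1 / ((sin \<theta>)\<^sup>2 + norm ((y - x) v* L) ^ (2 * CARD('n)) * (cos \<theta>)\<^sup>2)\<^sup>2)
                  * f y \<partial>lborel)"
    using ext[OF \<theta>] by blast
  have norm_L: "norm (z v* L) ^ (2 * CARD('n)) = Q z ^ CARD('n)" for z
    unfolding Q_def herm_form_eq_norm[OF L] by (simp add: power_mult)
  define J1 where "J1 = (\<integral>\<^sup>+z\<in>{z. Q z < 1}. ennreal ((norm (G (x + z)))\<^sup>2) * f (x + z) \<partial>lborel)"
  define J2 where "J2 = (\<integral>\<^sup>+z\<in>{z. Q z < 1}. ennreal ((norm (F (x + z)))\<^sup>2 / Q z ^ CARD('n)) * f (x + z) \<partial>lborel)"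
  define I where "I = (\<integral>\<^sup>+z\<in>{z. Q z < 1}. ennreal (1 / (s + (1 - s) * Q z ^ CARD('n))\<^sup>2) * f (x + z) \<partial>lborel)"
  have le': "ennreal (1 / s) * J1 + ennreal (1 / (1 - s)) * J2 \<le> I"
    using le unfolding set_nn_integral_translate sin cos E J1_def J2_def I_def
    by (simp add: norm_L mult.commute[of _ "1 - s"])
  have sI: "ennreal s * I \<le> ennreal (e * V + \<delta>)"
  proof -
    have I_eq: "I = (\<integral>\<^sup>+z. ennreal (1 / (s + (1 - s) * Q z ^ CARD('n))\<^sup>2) * g (x + z) * indicator {z. Q z < 1} z \<partial>lborel)"
      unfolding I_def by (intro nn_integral_cong) (auto simp: indicator_def g_eq)
    have "ennreal s * I = (\<integral>\<^sup>+z. ennreal s * (ennreal (1 / (s + (1 - s) * Q z ^ CARD('n))\<^sup>2) * g (x + z) * indicator {z. Q z < 1} z) \<partial>lborel)"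
      unfolding I_eq by (intro nn_integral_cmult[symmetric]) measurable
    also have "\<dots> = (\<integral>\<^sup>+z\<in>{z. Q z < 1}. ennreal (s / (s + (1 - s) * Q z ^ CARD('n))\<^sup>2) * g (x + z) \<partial>lborel)"
      using s by (simp add: mult.assoc[symmetric] ennreal_mult'[symmetric])
    also have "\<dots> \<le> ennreal C * ennreal V + ennreal (\<delta> / 2)" by (rule s_le)
    also have "\<dots> = ennreal (C * V + \<delta> / 2)"
      using C V_pos \<delta> by (simp add: ennreal_mult'[symmetric] ennreal_plus[symmetric] del: ennreal_plus)
    also have "C * V + \<delta> / 2 = e * V + \<delta>"
      using V_pos by (simp add: C_def field_simps)
    finally show ?thesis .
  qed
  \<comment> \<open>The nonnegative term with \<open>F\<close> is dropped and the inequality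
    multiplied by \<open>s\<close>.\<close>
  have "J1 = ennreal s * (ennreal (1 / s) * J1)"
    using s by (simp add: mult.assoc[symmetric] ennreal_mult'[symmetric])
  also have "\<dots> \<le> ennreal s * I"
    using le' by (intro mult_left_mono) (auto intro: order_trans[rotated])
  also note sI
  finally have J1: "J1 \<le> ennreal (e * V + \<delta>)" .
  have "I < \<infinity>"
  proof (rule ccontr)
    assume "\<not> I < \<infinity>"
    then have "I = top" by (simp add: less_top[symmetric])
    then show False using sI s by (simp add: ennreal_mult_top top_unique)
  qed
  \<comment> \<open>Now the term with \<open>G\<close> is dropped; only finiteness matters
    here.\<close>
  have "J2 = ennreal (1 - s) * (ennreal (1 / (1 - s)) * J2)"
    using s by (simp add: mult.assoc[symmetric] ennreal_mult'[symmetric])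
  also have "\<dots> \<le> ennreal (1 - s) * I"
    using le' by (intro mult_left_mono) (auto intro: order_trans[rotated])
  also have "\<dots> < \<infinity>" using \<open>I < \<infinity>\<close> by (simp add: ennreal_mult_less_top)
  finally have J2: "J2 < \<infinity>" .
  have F': "mv_holomorphic_on (\<lambda>z. F (x + z)) {z. Q z < 1}"
    and G': "mv_holomorphic_on (\<lambda>z. G (x + z)) {z. Q z < 1}"
    using F G unfolding E by (auto intro: mv_holomorphic_on_translate)
  obtain d where d: "d > 0" "\<And>y. dist y x < d \<Longrightarrow> ennreal c \<le> f y"
    using low(2) unfolding eventually_nhds_metric by blast
  obtain m where m: "m > 0" "\<And>z. m * (norm z)\<^sup>2 \<le> Q z"
    using Q_ge_norm_square by blast
  have "F (x + 0) = 0"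
  proof (rule zero_of_weighted_integrable[where F = "\<lambda>z. F (x + z)" and f = "\<lambda>z. f (x + z)" and r = "m * d\<^sup>2"])
    show "continuous_on {z. Q z < 1} (\<lambda>z. F (x + z))"
      using F' by (rule mv_holomorphic_on_imp_continuous_on)
    show "ennreal c \<le> f (x + z)" if "Q z < m * d\<^sup>2" for z
    proof -
      have "m * (norm z)\<^sup>2 < m * d\<^sup>2" using m(2)[of z] that by linarith
      then have "norm z < d" using m(1) d(1) by (simp add: power_less_imp_less_base)
      then show ?thesis by (intro d(2)) (simp add: dist_norm)
    qed
    show "(\<integral>\<^sup>+z\<in>{z. Q z < 1}. ennreal ((norm (F (x + z)))\<^sup>2 / Q z ^ CARD('n)) * f (x + z) \<partial>lborel) < \<infinity>"
      using J2 by (simp add: J2_def)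
  qed (use low m d in auto)
  then have "G (x + 0) = 1"
    using FG[of "x + 0"] by (simp add: E)
  then show ?thesis
    using that[OF G'] J1 by (simp add: J1_def V_def)
qed

section \<open>Thin ellipsoids around a complex line\<close>

lemma mv_holomorphic_on_mult:
  assumes "mv_holomorphic_on F S" "mv_holomorphic_on G S"
  shows "mv_holomorphic_on (\<lambda>z. F z * G z) S"
  unfolding mv_holomorphic_on_def
proof
  fix z assume z: "z \<in> S"
  obtain D where D: "(F has_derivative D) (at z)" "\<And>c v. D (c *s v) = c * D v"
    using assms(1) z unfolding mv_holomorphic_on_def by blast
  obtain D' where D': "(G has_derivative D') (at z)" "\<And>c v. D' (c *s v) = c * D' v"
    using assms(2) z unfolding mv_holomorphic_on_def by blast
  have "((\<lambda>z. F z * G z) has_derivative (\<lambda>h. F z * D' h + D h * G z)) (at z)"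
    using D(1) D'(1) by (rule has_derivative_mult)
  then show "\<exists>D. ((\<lambda>z. F z * G z) has_derivative D) (at z) \<and> (\<forall>c v. D (c *s v) = c * D v)"
    by (rule exI[of _ "\<lambda>h. F z * D' h + D h * G z", OF conjI]) (simp add: D(2) D'(2) algebra_simps)
qed

lemma mv_holomorphic_on_compose_linear:
  assumes g: "g holomorphic_on UNIV" and l: "bounded_linear l" "\<And>c v. l (c *s v) = c * l v"
  shows "mv_holomorphic_on (\<lambda>z. g (l z)) S"
  unfolding mv_holomorphic_on_def
proof
  fix z
  have "(g has_field_derivative deriv g (l z)) (at (l z))"
    using g by (rule holomorphic_derivI) auto
  then have "((\<lambda>z. g (l z)) has_derivative (\<lambda>h. deriv g (l z) * l h)) (at z)"
    using has_derivative_compose[OF bounded_linear_imp_has_derivative[OF l(1)]]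
    unfolding has_field_derivative_def by blast
  then show "\<exists>D. ((\<lambda>z. g (l z)) has_derivative D) (at z) \<and> (\<forall>c v. D (c *s v) = c * D v)"
    by (rule exI[of _ "\<lambda>h. deriv g (l z) * l h", OF conjI]) (simp add: l(2))
qed

text \<open>The coordinate along \<open>b\<close> of the orthogonal projection to the line spanned by \<open>b\<close>.\<close>

definition line_coord :: "complex^'n \<Rightarrow> complex^'n \<Rightarrow> complex" where
  "line_coord b z = (\<Sum>i\<in>UNIV. z $ i * cnj (b $ i)) / complex_of_real ((norm b)\<^sup>2)"

lemma line_coord_scalar_mult [simp]: "line_coord b (c *s z) = c * line_coord b z"
  by (simp add: line_coord_def sum_distrib_left mult_ac)

lemma line_coord_add: "line_coord b (z + w) = line_coord b z + line_coord b w"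
  by (simp add: line_coord_def sum.distrib add_divide_distrib algebra_simps)

lemma line_coord_scaleR: "line_coord b (r *\<^sub>R z) = complex_of_real r * line_coord b z"
  by (simp add: scaleR_eq_scalar_mult)

lemma line_coord_self: "b \<noteq> 0 \<Longrightarrow> line_coord b b = 1"
  by (simp add: line_coord_def norm_vec_square[symmetric] del: of_real_power)

lemma bounded_linear_line_coord: "bounded_linear (line_coord b)"
  unfolding linear_conv_bounded_linear[symmetric]
  by (rule linearI) (simp_all only: line_coord_add line_coord_scaleR scaleR_conv_of_real[where 'a=complex])

lemma line_coord_measurable [measurable]: "line_coord b \<in> borel_measurable borel"
  by (intro borel_measurable_continuous_onI linear_continuous_on bounded_linear_line_coord)

text \<open>Pythagoras for the orthogonal decomposition of \<open>z\<close> into its projection to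
  the line and the remainder.\<close>

lemma norm_square_line_coord:
  assumes "b \<noteq> 0"
  shows "(norm z)\<^sup>2 = (norm (z - line_coord b z *s b))\<^sup>2 + (cmod (line_coord b z))\<^sup>2 * (norm b)\<^sup>2"
proof -
  define l where "l = line_coord b z"
  have zb: "(\<Sum>i\<in>UNIV. z $ i * cnj (b $ i)) = l * complex_of_real ((norm b)\<^sup>2)"
    using assms by (simp add: l_def line_coord_def)
  have bz: "(\<Sum>i\<in>UNIV. b $ i * cnj (z $ i)) = cnj l * complex_of_real ((norm b)\<^sup>2)"
  proof -
    have "(\<Sum>i\<in>UNIV. b $ i * cnj (z $ i)) = cnj (\<Sum>i\<in>UNIV. z $ i * cnj (b $ i))"
      by (simp add: cnj_sum mult.commute)
    then show ?thesis unfolding zb by simp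
  qed
  have "complex_of_real ((norm (z - l *s b))\<^sup>2)
    = (\<Sum>i\<in>UNIV. z $ i * cnj (z $ i)) - cnj l * (\<Sum>i\<in>UNIV. z $ i * cnj (b $ i))
      - l * (\<Sum>i\<in>UNIV. b $ i * cnj (z $ i)) + l * cnj l * (\<Sum>i\<in>UNIV. b $ i * cnj (b $ i))"
    unfolding norm_vec_square sum_distrib_left sum.distrib[symmetric] sum_subtractf[symmetric]
    by (intro sum.cong refl) (simp add: algebra_simps)
  also have "\<dots> = complex_of_real ((norm z)\<^sup>2) - l * cnj l * complex_of_real ((norm b)\<^sup>2)"
    unfolding norm_vec_square[symmetric] zb bz by (simp add: algebra_simps)
  also have "\<dots> = complex_of_real ((norm z)\<^sup>2 - (cmod l)\<^sup>2 * (norm b)\<^sup>2)"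
    by (simp only: complex_norm_square[symmetric] of_real_mult of_real_diff)
  finally show ?thesis
    unfolding of_real_eq_iff l_def by simp
qed

text \<open>The matrix is \<open>M\<close> times the identity plus a rank one term along
  \<open>b\<close>. By Pythagoras the identity part already contributes \<open>M |b|^2\<close> to
  the coefficient of \<open>|line_coord b z|^2\<close>, and \<alpha> corrects this coefficient to
  \<open>R\<close>.\<close>

lemma exists_pos_def_hermitian_line:
  fixes b :: "complex^'n"
  assumes b: "b \<noteq> 0" and pos: "0 < R" "0 < M"
  obtains A :: "complex^'n^'n" where "pos_def_hermitian A"
    "\<And>z. Re (herm_form A z) = R * (cmod (line_coord b z))\<^sup>2 + M * (norm (z - line_coord b z *s b))\<^sup>2"
proof -
  define \<alpha> where "\<alpha> = (R - M * (norm b)\<^sup>2) / (norm b) ^ 4"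
  define A :: "complex^'n^'n" where
    "A = (\<chi> i j. complex_of_real \<alpha> * (cnj (b $ i) * b $ j) + (if i = j then complex_of_real M else 0))"
  have form: "Re (herm_form A z) = R * (cmod (line_coord b z))\<^sup>2 + M * (norm (z - line_coord b z *s b))\<^sup>2" for z
  proof -
    define h where "h = (\<Sum>i\<in>UNIV. z $ i * cnj (b $ i))"
    have "herm_form A z = complex_of_real \<alpha> * (\<Sum>i\<in>UNIV. \<Sum>j\<in>UNIV. (z $ i * cnj (b $ i)) * cnj (z $ j * cnj (b $ j)))
      + complex_of_real M * (\<Sum>i\<in>UNIV. z $ i * cnj (z $ i))"
      unfolding herm_form_def A_def sum_distrib_left sum.distrib[symmetric]
    proof (intro sum.cong refl)
      fix i
      have "(\<Sum>j\<in>UNIV. (if i = j then complex_of_real M else 0) * z $ i * cnj (z $ j))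
          = (\<Sum>j\<in>UNIV. if i = j then complex_of_real M * z $ i * cnj (z $ j) else 0)"
        by (intro sum.cong) auto
      then show "(\<Sum>j\<in>UNIV. (\<chi> i j. complex_of_real \<alpha> * (cnj (b $ i) * b $ j) + (if i = j then complex_of_real M else 0)) $ i $ j * z $ i * cnj (z $ j))
        = (\<Sum>j\<in>UNIV. complex_of_real \<alpha> * (z $ i * cnj (b $ i) * cnj (z $ j * cnj (b $ j)))) + complex_of_real M * (z $ i * cnj (z $ i))"
        by (simp add: algebra_simps sum.distrib)
    qed
    also have "\<dots> = complex_of_real (\<alpha> * (cmod h)\<^sup>2 + M * (norm z)\<^sup>2)"
      unfolding norm_vec_square[symmetric] of_real_add of_real_mult complex_norm_square
      by (simp add: h_def sum_product)
    finally have "Re (herm_form A z) = \<alpha> * (cmod h)\<^sup>2 + M * (norm z)\<^sup>2" by simp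
    moreover have "(cmod h)\<^sup>2 = (cmod (line_coord b z))\<^sup>2 * (norm b) ^ 4"
      using b by (simp add: line_coord_def h_def[symmetric] norm_divide power_divide norm_power)
    ultimately show ?thesis
      using b norm_square_line_coord[OF b, of z] by (simp add: \<alpha>_def field_simps)
  qed
  have "0 < Re (herm_form A z)" if "z \<noteq> 0" for z
  proof (cases "line_coord b z = 0")
    case True
    then show ?thesis using that pos by (simp add: form)
  next
    case False
    then show ?thesis unfolding form using pos by (intro add_pos_nonneg) auto
  qed
  moreover have "conj_transpose A = A"
    by (simp add: conj_transpose_def A_def vec_eq_iff mult_ac)
  ultimately show ?thesis
    using that[of A] form by (simp add: pos_def_hermitian_def)
qed

text \<open>The translated ellipsoid \<open>r b / 2 + E / 4\<close> lies in \<open>E\<close>, and there the coordinate along \<open>b\<close>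
  has modulus at least \<open>r / 4\<close>.\<close>

lemma nn_integral_line_coord_ge:
  fixes b :: "complex^'n" and r M :: real
  defines "E \<equiv> {z. (cmod (line_coord b z))\<^sup>2 / r\<^sup>2 + M * (norm (z - line_coord b z *s b))\<^sup>2 < 1}"
  assumes b: "b \<noteq> 0" and r: "0 < r" and M: "0 < M"
  shows "ennreal (r\<^sup>2 / 16 * (1/4) ^ DIM(complex^'n)) * emeasure lborel E
    \<le> (\<integral>\<^sup>+z\<in>E. ennreal ((cmod (line_coord b z))\<^sup>2) \<partial>lborel)"
proof -
  define l where "l = line_coord b"
  define p where "p z = z - l z *s b" for z
  have E: "E = {z. (cmod (l z))\<^sup>2 / r\<^sup>2 + M * (norm (p z))\<^sup>2 < 1}"
    by (simp add: E_def l_def p_def)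
  define c where "c = complex_of_real (r / 2) *s b"
  have [measurable]: "l \<in> borel_measurable borel" by (simp add: l_def)
  have "continuous_on UNIV p"
    unfolding p_def l_def vector_scalar_mult_def
    by (intro continuous_intros linear_continuous_on bounded_linear_line_coord)
  then have [measurable]: "p \<in> borel_measurable borel" by (rule borel_measurable_continuous_onI)
  have [measurable]: "E \<in> sets borel" unfolding E by measurable
  define h where "h z = ennreal ((cmod (l z))\<^sup>2) * indicator E z" for z
  have [measurable]: "h \<in> borel_measurable borel" unfolding h_def by measurable
  have h_ge: "ennreal (r\<^sup>2 / 16) * indicator E z \<le> h (c + (1/4) *\<^sub>R z)" for z
  proof (cases "z \<in> E")
    case True
    define w where "w = c + (1/4) *\<^sub>R z"
    define s where "s = cmod (l z)"
    have lw: "l w = complex_of_real (r / 2) + complex_of_real (1/4) * l z"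
      by (simp only: w_def l_def line_coord_add line_coord_scaleR c_def line_coord_scalar_mult
          line_coord_self[OF b] mult_1_right)
    have pw: "p w = (1/4) *\<^sub>R p z"
      by (simp only: p_def lw) (simp add: w_def c_def vec_eq_iff complex_eq_iff algebra_simps diff_divide_distrib)
    have "(cmod (l z))\<^sup>2 / r\<^sup>2 < 1"
    proof -
      have "0 \<le> M * (norm (p z))\<^sup>2" using M by simp
      then show ?thesis using True unfolding E mem_Collect_eq by linarith
    qed
    then have "s\<^sup>2 < r\<^sup>2" using r by (simp add: s_def)
    then have s: "s < r" "0 \<le> s" using r by (auto simp: s_def power_less_imp_less_base)
    have c14: "cmod (complex_of_real (1/4) * l z) = s / 4"
      unfolding norm_mult by (simp add: s_def)
    have "cmod (complex_of_real (r/2)) = r / 2" using r by simp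
    then have lw_le: "cmod (l w) \<le> r / 2 + s / 4" and lw_ge: "r / 2 - s / 4 \<le> cmod (l w)"
      using norm_triangle_ineq[of "complex_of_real (r/2)" "complex_of_real (1/4) * l z"]
        norm_diff_ineq[of "complex_of_real (r/2)" "complex_of_real (1/4) * l z"] c14 lw by simp_all
    have "(r / 4)\<^sup>2 \<le> (cmod (l w))\<^sup>2"
      using lw_ge s r by (intro power_mono) auto
    then have "ennreal (r\<^sup>2 / 16) \<le> ennreal ((cmod (l w))\<^sup>2)"
      by (intro ennreal_leI) (simp add: power_divide)
    \<comment> \<open>The coordinate along \<open>b\<close> is at most \<open>r/2 + r/4\<close> in
      modulus and contributes at most \<open>9/16\<close>; the transverse part, scaled by
      \<open>1/4\<close>, contributes less than \<open>1/16\<close>.\<close>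
    moreover have "w \<in> E"
    proof -
      have "(cmod (l w))\<^sup>2 / r\<^sup>2 \<le> (3 * r / 4)\<^sup>2 / r\<^sup>2"
        using lw_le s r by (intro divide_right_mono power_mono) auto
      also have "\<dots> = 9 / 16" using r by (simp add: power2_eq_square field_simps)
      finally have "(cmod (l w))\<^sup>2 / r\<^sup>2 \<le> 9 / 16" .
      moreover have "M * (norm (p w))\<^sup>2 = M * (norm (p z))\<^sup>2 / 16"
        by (simp add: pw power_divide)
      moreover have "M * (norm (p z))\<^sup>2 < 1"
      proof -
        have "0 \<le> (cmod (l z))\<^sup>2 / r\<^sup>2" by simp
        then show ?thesis using True unfolding E mem_Collect_eq by linarith
      qed
      ultimately show ?thesis unfolding E mem_Collect_eq by linarith
    qed
    ultimately show ?thesis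
      using True by (simp add: h_def w_def)
  qed simp
  have "ennreal (r\<^sup>2 / 16 * (1/4) ^ DIM(complex^'n)) * emeasure lborel E
      = ennreal ((1/4) ^ DIM(complex^'n)) * (ennreal (r\<^sup>2 / 16) * emeasure lborel E)"
    by (simp only: mult.commute[of "r\<^sup>2 / 16"] mult.assoc[symmetric])
       (subst ennreal_mult, auto)
  also have "ennreal (r\<^sup>2 / 16) * emeasure lborel E = (\<integral>\<^sup>+z. ennreal (r\<^sup>2 / 16) * indicator E z \<partial>lborel)"
    by (simp add: nn_integral_cmult)
  also have "\<dots> \<le> (\<integral>\<^sup>+z. h (c + (1/4) *\<^sub>R z) \<partial>lborel)"
    by (intro nn_integral_mono h_ge)
  also have "ennreal ((1/4) ^ DIM(complex^'n)) * \<dots> = (\<integral>\<^sup>+z. h (c + z) \<partial>lborel)"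
    by (rule nn_integral_lborel_scaleR[symmetric]) auto
  also have "\<dots> = (\<integral>\<^sup>+z. h z \<partial>lborel)" by (rule nn_integral_lborel_translate)
  finally show ?thesis by (simp add: h_def l_def mult_left_mono)
qed

section \<open>Maximum principle\<close>

lemma usc_onD:
  assumes "usc_on S u" "x \<in> S"
  shows "u x < \<infinity>" "u x < c \<Longrightarrow> \<forall>\<^sub>F y in at x within S. u y < c"
  using assms by (auto simp: usc_on_def)

text \<open>A real constant strictly between \<phi> and \<open>g\<close> at a point separates them
  in a neighbourhood.\<close>

lemma open_usc_less:
  fixes \<phi> :: "'a::metric_space \<Rightarrow> ereal" and g :: "'a \<Rightarrow> real"
  assumes "open \<Omega>" and usc: "usc_on \<Omega> \<phi>" and g: "continuous_on UNIV g"
  shows "open {y\<in>\<Omega>. \<phi> y < ereal (g y)}"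
proof (subst open_subopen, safe)
  fix x assume x: "x \<in> \<Omega>" "\<phi> x < ereal (g x)"
  then obtain c where c: "\<phi> x < ereal c" "c < g x"
    using ereal_dense2[OF x(2)] by auto
  have "\<forall>\<^sub>F y in at x. \<phi> y < ereal c"
    using usc_onD(2)[OF usc x(1) c(1)] at_within_open[OF x(1) \<open>open \<Omega>\<close>] by simp
  then have "\<forall>\<^sub>F y in nhds x. \<phi> y < ereal c"
    using c(1) by (simp add: eventually_nhds_conv_at)
  moreover have "\<forall>\<^sub>F y in nhds x. c < g y"
  proof -
    have "isCont g x" using g by (simp add: continuous_on_eq_continuous_at)
    then have "(g \<longlongrightarrow> g x) (nhds x)" by (simp add: isCont_def tendsto_at_iff_tendsto_nhds)
    then show ?thesis using c(2) by (rule order_tendstoD(1))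
  qed
  moreover have "\<forall>\<^sub>F y in nhds x. y \<in> \<Omega>"
    using x(1) \<open>open \<Omega>\<close> by (rule eventually_nhds_in_open[rotated])
  ultimately have "\<forall>\<^sub>F y in nhds x. y \<in> {y\<in>\<Omega>. \<phi> y < ereal (g y)}"
    by eventually_elim (auto intro: less_trans)
  then show "\<exists>T. open T \<and> x \<in> T \<and> T \<subseteq> {y \<in> \<Omega>. \<phi> y < ereal (g y)}"
    unfolding eventually_nhds by blast
qed

text \<open>If no maximum exists, every \<open>x\<close> has some \<open>m x\<close> with a larger
  value, and \<open>u (m x)\<close> bounds \<open>u\<close> strictly near \<open>x\<close>. By
  compactness finitely many of these bounds suffice, and the point attaining the largest of them
  would lie strictly below that same bound.\<close>

lemma usc_attains_max:
  fixes u :: "'a::topological_space \<Rightarrow> ereal"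
  assumes K: "compact K" "K \<noteq> {}"
    and usc: "\<And>x c. x \<in> K \<Longrightarrow> u x < c \<Longrightarrow> \<forall>\<^sub>F y in nhds x. y \<in> K \<longrightarrow> u y < c"
  obtains x where "x \<in> K" "\<And>y. y \<in> K \<Longrightarrow> u y \<le> u x"
proof (rule ccontr)
  assume "\<not> thesis"
  then have "\<forall>x\<in>K. \<exists>y\<in>K. u x < u y"
    using that by (meson not_le)
  then obtain m where m: "\<And>x. x \<in> K \<Longrightarrow> m x \<in> K" "\<And>x. x \<in> K \<Longrightarrow> u x < u (m x)"
    by metis
  have "\<forall>x\<in>K. \<exists>U. open U \<and> x \<in> U \<and> (\<forall>y\<in>U. y \<in> K \<longrightarrow> u y < u (m x))"
    using usc m(2) unfolding eventually_nhds by blast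
  then obtain U where U: "\<And>x. x \<in> K \<Longrightarrow> open (U x)" "\<And>x. x \<in> K \<Longrightarrow> x \<in> U x"
    "\<And>x y. x \<in> K \<Longrightarrow> y \<in> U x \<Longrightarrow> y \<in> K \<Longrightarrow> u y < u (m x)"
    by metis
  obtain X where X: "X \<subseteq> K" "finite X" "K \<subseteq> (\<Union>x\<in>X. U x)"
    using compactE_image[OF K(1), of K U] U by (metis UN_I subsetI)
  have "X \<noteq> {}" using X(3) K(2) by auto
  then have "Max ((\<lambda>y. u (m y)) ` X) \<in> (\<lambda>y. u (m y)) ` X"
    using X(2) by (intro Max_in) auto
  then obtain x where x: "x \<in> X" "Max ((\<lambda>y. u (m y)) ` X) = u (m x)"
    by blast
  have x_max: "u (m y) \<le> u (m x)" if "y \<in> X" for y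
    unfolding x(2)[symmetric] using X(2) that by (intro Max_ge) auto
  have "m x \<in> K" using x(1) X(1) m(1) by blast
  then obtain y where "y \<in> X" "m x \<in> U y" using X(3) by blast
  then have "u (m x) < u (m y)"
    using U(3) X(1) \<open>m x \<in> K\<close> by blast
  with x_max[OF \<open>y \<in> X\<close>] show False by simp
qed

text \<open>On a thin ellipsoid around the disc semicontinuity costs a factor
  \<open>exp \<delta>\<close>, while the mean value property gains the factor
  \<open>1 + \<eta> \<kappa> = exp (2 \<delta>)\<close>. The gain is fixed before the thickness is
  chosen, so a contradiction remains.\<close>

lemma no_strict_local_max:
  fixes \<Omega> :: "(complex^'n) set" and \<phi> :: "complex^'n \<Rightarrow> ereal"
  assumes "open \<Omega>" and usc: "usc_on \<Omega> \<phi>" and b: "b \<noteq> 0"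
    and q: "q holomorphic_on UNIV" "q 0 = 0" and \<eta>: "0 < \<eta>" and r: "0 < r"
    and \<phi>x: "\<phi> x = ereal e"
    and le: "\<And>t. cmod t \<le> r \<Longrightarrow> x + t *s b \<in> \<Omega>"
      "\<And>t. cmod t \<le> r \<Longrightarrow> \<phi> (x + t *s b) \<le> ereal (e + Re (q t) - \<eta> * (cmod t)\<^sup>2)"
    and ext: "\<And>(A :: complex^'n^'n) \<delta>. pos_def_hermitian A \<Longrightarrow> 0 < \<delta> \<Longrightarrow> (+) x ` {z. Re (herm_form A z) \<le> 1} \<subseteq> \<Omega> \<Longrightarrow>
      \<exists>G. mv_holomorphic_on G {z. Re (herm_form A z) < 1} \<and> G 0 = 1 \<and>
        (\<integral>\<^sup>+z\<in>{z. Re (herm_form A z) < 1}. ennreal ((norm (G z))\<^sup>2) * exp_neg (\<phi> (x + z)) \<partial>lborel)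
          \<le> ennreal (exp (- e) * measure lborel {z. Re (herm_form A z) < 1} + \<delta>)"
  shows False
proof -
  \<comment> \<open>This is the constant of \<open>nn_integral_line_coord_ge\<close>; it involves
    the radius of the disc and the dimension, but not \<open>M\<close>.\<close>
  define \<kappa> where "\<kappa> = r\<^sup>2 / 16 * (1/4) ^ DIM(complex^'n)"
  have \<kappa>: "0 < \<kappa>" using r by (simp add: \<kappa>_def)
  define \<delta> where "\<delta> = ln (1 + \<eta> * \<kappa>) / 2"
  have \<eta>\<kappa>: "0 < \<eta> * \<kappa>" using \<eta> \<kappa> by simp
  then have \<delta>: "0 < \<delta>" by (simp add: \<delta>_def ln_gt_zero)
  have exp_\<delta>: "1 + \<eta> * \<kappa> = exp \<delta> * exp \<delta>"
    using \<eta>\<kappa> by (simp add: \<delta>_def exp_add[symmetric])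
  define l where "l = line_coord b"
  have l_cont: "continuous_on UNIV l"
    unfolding l_def by (rule linear_continuous_on[OF bounded_linear_line_coord])
  have q_cont: "continuous_on UNIV q"
    using q(1) by (rule holomorphic_on_imp_continuous_on)
  \<comment> \<open>The upper bound on the disc, relaxed by \<delta> and extended through the
    coordinate along \<open>b\<close>, holds on an open set; by compactness this set contains a
    uniform neighbourhood of the disc.\<close>
  define W where "W = {y\<in>\<Omega>. \<phi> y < ereal (e + Re (q (l (y - x))) - \<eta> * (cmod (l (y - x)))\<^sup>2 + \<delta>)}"
  have "open W"
    unfolding W_def
    by (intro open_usc_less \<open>open \<Omega>\<close> usc continuous_intros continuous_on_compose2[OF q_cont]
        continuous_on_compose2[OF l_cont]) auto
  define K where "K = (\<lambda>t. x + t *s b) ` cball 0 r"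
  have "compact K"
    unfolding K_def
    by (intro compact_continuous_image continuous_intros compact_cball)
       (auto intro: linear_continuous_on bounded_linear_vector_scalar_mult_left)
  moreover have "K \<subseteq> W"
  proof (clarsimp simp: K_def)
    fix t :: complex assume t: "cmod t \<le> r"
    have "l (x + t *s b - x) = t" by (simp add: l_def line_coord_self[OF b])
    moreover have "\<phi> (x + t *s b) < ereal (e + Re (q t) - \<eta> * (cmod t)\<^sup>2 + \<delta>)"
      using le(2)[OF t] by (rule le_less_trans) (use \<delta> in simp)
    ultimately show "x + t *s b \<in> W" using le(1)[OF t] by (simp add: W_def)
  qed
  ultimately obtain \<epsilon> where \<epsilon>: "\<epsilon> > 0" "(\<Union>y\<in>K. ball y \<epsilon>) \<subseteq> W"
    using \<open>open W\<close> compact_subset_open_imp_ball_epsilon_subset[of K W] by blast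
  \<comment> \<open>With this weight points with \<open>Q z \<le> 1\<close> are within
    \<open>\<epsilon> / 2\<close> of the line, and their projections lie in the disc.\<close>
  define M where "M = 4 / \<epsilon>\<^sup>2"
  have M: "0 < M" using \<epsilon> by (simp add: M_def)
  obtain A :: "complex^'n^'n" where A: "pos_def_hermitian A"
    and form: "\<And>z. Re (herm_form A z) = (1 / r\<^sup>2) * (cmod (l z))\<^sup>2 + M * (norm (z - l z *s b))\<^sup>2"
    unfolding l_def using exists_pos_def_hermitian_line[OF b, of "1 / r\<^sup>2" M] M r by auto
  define Q where "Q z = Re (herm_form A z)" for z
  interpret hermitian_gauge Q
    unfolding Q_def using A by (rule hermitian_gauge_herm_form)
  have sub: "x + z \<in> W" if "Q z \<le> 1" for z
  proof -
    have "0 \<le> M * (norm (z - l z *s b))\<^sup>2" "0 \<le> (1 / r\<^sup>2) * (cmod (l z))\<^sup>2" using M by auto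
    then have 1: "(1 / r\<^sup>2) * (cmod (l z))\<^sup>2 \<le> 1" "M * (norm (z - l z *s b))\<^sup>2 \<le> 1"
      using that form[of z] unfolding Q_def by linarith+
    then have "(cmod (l z))\<^sup>2 \<le> r\<^sup>2" using r by (simp add: field_simps)
    then have "cmod (l z) \<le> r" by (rule power2_le_imp_le) (use r in auto)
    then have K: "x + l z *s b \<in> K" by (auto simp: K_def)
    have "(norm (z - l z *s b))\<^sup>2 \<le> (\<epsilon> / 2)\<^sup>2"
      using 1(2) \<epsilon>(1) by (simp add: M_def field_simps power_divide)
    then have "norm (z - l z *s b) \<le> \<epsilon> / 2" by (rule power2_le_imp_le) (use \<epsilon>(1) in auto)
    then have "x + z \<in> ball (x + l z *s b) \<epsilon>"
      using \<epsilon>(1) by (simp add: dist_norm norm_minus_commute)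
    then show ?thesis using K \<epsilon>(2) by blast
  qed
  then have subset: "(+) x ` {z. Re (herm_form A z) \<le> 1} \<subseteq> \<Omega>"
    by (auto simp: Q_def W_def)
  \<comment> \<open>Half of the final gap between \<open>exp (- e) V exp \<delta>\<close> and
    \<open>exp (- e) V\<close>.\<close>
  define \<gamma> where "\<gamma> = exp (- e) * V * (exp \<delta> - 1) / 2"
  have \<gamma>: "0 < \<gamma>" using V_pos \<delta> by (simp add: \<gamma>_def)
  obtain G where G: "mv_holomorphic_on G {z. Q z < 1}" "G 0 = 1"
    and G_le: "(\<integral>\<^sup>+z\<in>{z. Q z < 1}. ennreal ((norm (G z))\<^sup>2) * exp_neg (\<phi> (x + z)) \<partial>lborel)
      \<le> ennreal (exp (- e) * V + \<gamma>)"
    using ext[OF A \<gamma> subset] unfolding V_def Q_def by blast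
  \<comment> \<open>The holomorphic factor absorbs the pluriharmonic term:
    \<open>|H|^2 = |G|^2 exp (- Re q)\<close>, and \<open>q 0 = 0\<close> keeps the value 1 at the
    centre.\<close>
  define H where "H z = G z * exp (- q (l z) / 2)" for z
  have "mv_holomorphic_on H {z. Q z < 1}"
    unfolding H_def
    by (intro mv_holomorphic_on_mult G(1) mv_holomorphic_on_compose_linear[where g = "\<lambda>t. exp (- q t / 2)"] holomorphic_intros q(1))
       (auto simp: l_def bounded_linear_line_coord)
  moreover have "H 0 = 1"
  proof -
    have "l 0 = 0" unfolding l_def by (rule linear_simps(3)[OF bounded_linear_line_coord])
    then show ?thesis by (simp add: H_def G(2) q(2))
  qed
  moreover have [measurable]: "l \<in> borel_measurable borel" by (simp add: l_def)
  define k where "k z = ennreal (1 + \<eta> * (cmod (l z))\<^sup>2)" for z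
  have [measurable]: "k \<in> borel_measurable borel" unfolding k_def by measurable
  ultimately have mean: "(\<integral>\<^sup>+z\<in>{z. Q z < 1}. k z \<partial>lborel)
    \<le> (\<integral>\<^sup>+z\<in>{z. Q z < 1}. ennreal ((norm (H z))\<^sup>2) * k z \<partial>lborel)"
    by (intro nn_integral_norm_square_ge) (auto simp: k_def l_def norm_mult)
  have "ennreal (V + \<eta> * (\<kappa> * V)) = ennreal V + ennreal \<eta> * (ennreal \<kappa> * ennreal V)"
    using V_pos \<eta> \<kappa> by (simp add: ennreal_mult)
  also have "ennreal \<kappa> * ennreal V \<le> (\<integral>\<^sup>+z\<in>{z. Q z < 1}. ennreal ((cmod (l z))\<^sup>2) \<partial>lborel)"
    using nn_integral_line_coord_ge[OF b r M]
    unfolding emeasure_Q_less_1[symmetric] \<kappa>_def Q_def form l_def by simp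
  also have "ennreal V + ennreal \<eta> * (\<integral>\<^sup>+z\<in>{z. Q z < 1}. ennreal ((cmod (l z))\<^sup>2) \<partial>lborel)
    = (\<integral>\<^sup>+z. indicator {z. Q z < 1} z + ennreal \<eta> * (ennreal ((cmod (l z))\<^sup>2) * indicator {z. Q z < 1} z) \<partial>lborel)"
    by (subst nn_integral_add) (auto simp: nn_integral_cmult emeasure_Q_less_1)
  also have "\<dots> = (\<integral>\<^sup>+z\<in>{z. Q z < 1}. k z \<partial>lborel)"
  proof (intro nn_integral_cong)
    fix z
    have "k z = 1 + ennreal \<eta> * ennreal ((cmod (l z))\<^sup>2)"
      using \<eta> by (simp add: k_def ennreal_mult)
    then show "indicator {z. Q z < 1} z + ennreal \<eta> * (ennreal ((cmod (l z))\<^sup>2) * indicator {z. Q z < 1} z)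
        = k z * indicator {z. Q z < 1} z"
      by (simp add: indicator_def)
  qed
  also note mean
  finally have lower: "ennreal (V + \<eta> * (\<kappa> * V)) \<le> (\<integral>\<^sup>+z\<in>{z. Q z < 1}. ennreal ((norm (H z))\<^sup>2) * k z \<partial>lborel)"
    by (simp add: mult_left_mono add_left_mono)
  have pointwise: "ennreal (exp (- e - \<delta>)) * (ennreal ((norm (H z))\<^sup>2) * k z)
      \<le> ennreal ((norm (G z))\<^sup>2) * exp_neg (\<phi> (x + z))" if "Q z < 1" for z
  proof -
    define m where "m = e + Re (q (l z)) - \<eta> * (cmod (l z))\<^sup>2 + \<delta>"
    have "\<phi> (x + z) < ereal m"
      using sub[of z] that by (simp add: W_def m_def)
    then have m_le: "ennreal (exp (- m)) \<le> exp_neg (\<phi> (x + z))"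
      by (cases "\<phi> (x + z)") (auto simp: exp_neg_def intro: ennreal_leI)
    have le1: "exp (- e - \<delta>) * ((norm (H z))\<^sup>2 * (1 + \<eta> * (cmod (l z))\<^sup>2)) \<le> (norm (G z))\<^sup>2 * exp (- m)"
    proof -
      have "(norm (exp (- q (l z) / 2)))\<^sup>2 = exp (- Re (q (l z)))"
        by (simp add: norm_exp_eq_Re exp_double[symmetric])
      then have "exp (- e - \<delta>) * ((norm (H z))\<^sup>2 * (1 + \<eta> * (cmod (l z))\<^sup>2))
        = (norm (G z))\<^sup>2 * (exp (- e - \<delta>) * exp (- Re (q (l z))) * (1 + \<eta> * (cmod (l z))\<^sup>2))"
        by (simp add: H_def norm_mult power_mult_distrib)
      \<comment> \<open>The inequality \<open>1 + y \<le> exp y\<close> matches the polynomial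
        weight with the quadratic term in the exponent of the bound on \<phi>.\<close>
      also have "\<dots> \<le> (norm (G z))\<^sup>2 * (exp (- e - \<delta>) * exp (- Re (q (l z))) * exp (\<eta> * (cmod (l z))\<^sup>2))"
        by (intro mult_left_mono exp_ge_add_one_self) auto
      also have "\<dots> = (norm (G z))\<^sup>2 * exp (- m)"
        by (simp add: m_def exp_add[symmetric])
      finally show ?thesis .
    qed
    have eq1: "ennreal (exp (- e - \<delta>)) * (ennreal ((norm (H z))\<^sup>2) * k z)
        = ennreal (exp (- e - \<delta>) * ((norm (H z))\<^sup>2 * (1 + \<eta> * (cmod (l z))\<^sup>2)))"
      using \<eta> unfolding k_def by (simp only: ennreal_mult ennreal_mult' exp_ge_zero zero_le_power2)
    have eq2: "ennreal ((norm (G z))\<^sup>2 * exp (- m)) = ennreal ((norm (G z))\<^sup>2) * ennreal (exp (- m))"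
      by (intro ennreal_mult) auto
    have "ennreal (exp (- e - \<delta>)) * (ennreal ((norm (H z))\<^sup>2) * k z)
        \<le> ennreal ((norm (G z))\<^sup>2) * ennreal (exp (- m))"
      unfolding eq1 eq2[symmetric] using le1 by (rule ennreal_leI)
    also have "\<dots> \<le> ennreal ((norm (G z))\<^sup>2) * exp_neg (\<phi> (x + z))"
      using m_le by (intro mult_left_mono) auto
    finally show ?thesis .
  qed
  have [measurable]: "(\<lambda>z. indicator {z. Q z < 1} z *\<^sub>R H z) \<in> borel_measurable borel"
    using \<open>mv_holomorphic_on H {z. Q z < 1}\<close>
    by (intro borel_measurable_continuous_on_indicator mv_holomorphic_on_imp_continuous_on
        borel_open open_Q_less)
  have H_ind: "ennreal ((norm (H z))\<^sup>2) * k z * indicator {z. Q z < 1} z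
      = ennreal ((norm (indicator {z. Q z < 1} z *\<^sub>R H z))\<^sup>2) * k z" for z
    by (simp add: indicator_def)
  have "ennreal (exp (- e - \<delta>) * (V + \<eta> * (\<kappa> * V))) = ennreal (exp (- e - \<delta>)) * ennreal (V + \<eta> * (\<kappa> * V))"
    by (simp add: ennreal_mult')
  also have "\<dots> \<le> ennreal (exp (- e - \<delta>)) * (\<integral>\<^sup>+z\<in>{z. Q z < 1}. ennreal ((norm (H z))\<^sup>2) * k z \<partial>lborel)"
    by (intro mult_left_mono lower) simp
  also have "\<dots> = (\<integral>\<^sup>+z. ennreal (exp (- e - \<delta>)) * (ennreal ((norm (H z))\<^sup>2) * k z * indicator {z. Q z < 1} z) \<partial>lborel)"
    unfolding H_ind by (intro nn_integral_cmult[symmetric]) measurable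
  also have "\<dots> \<le> (\<integral>\<^sup>+z\<in>{z. Q z < 1}. ennreal ((norm (G z))\<^sup>2) * exp_neg (\<phi> (x + z)) \<partial>lborel)"
    using pointwise by (intro nn_integral_mono) (auto simp: indicator_def)
  also note G_le
  \<comment> \<open>The left-hand side equals \<open>exp (- e) V exp \<delta>\<close>, which exceeds
    \<open>exp (- e) V\<close> by \<open>2 \<gamma>\<close>.\<close>
  finally have "exp (- e - \<delta>) * (V + \<eta> * (\<kappa> * V)) \<le> exp (- e) * V + \<gamma>"
    using V_pos \<gamma> by (subst (asm) ennreal_le_iff) (auto intro: add_nonneg_nonneg)
  moreover have "exp (- e - \<delta>) * (V + \<eta> * (\<kappa> * V)) = exp (- e) * V * exp \<delta>"
  proof -
    have "V + \<eta> * (\<kappa> * V) = V * (exp \<delta> * exp \<delta>)" by (simp add: exp_\<delta>[symmetric] algebra_simps)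
    then show ?thesis by (simp add: exp_diff)
  qed
  moreover have "exp (- e) * V * exp \<delta> - exp (- e) * V = 2 * \<gamma>"
    by (simp add: \<gamma>_def algebra_simps)
  ultimately show False using \<gamma> by simp
qed

section \<open>Restriction to complex lines and harmonic majorants\<close>

lemma open_line_preimage:
  fixes \<Omega> :: "(complex^'n) set"
  assumes "open \<Omega>"
  shows "open {t. a + t *s b \<in> \<Omega>}"
proof -
  have "open ((\<lambda>t. a + t *s b) -` \<Omega>)"
    using assms by (intro open_vimage continuous_intros linear_continuous_on bounded_linear_vector_scalar_mult_left)
  then show ?thesis by (simp add: vimage_def)
qed

lemma usc_on_line:
  fixes \<phi> :: "complex^'n \<Rightarrow> ereal"
  assumes "usc_on \<Omega> \<phi>"
  shows "usc_on {t. a + t *s b \<in> \<Omega>} (\<lambda>t. \<phi> (a + t *s b))"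
  unfolding usc_on_def
proof (intro ballI conjI allI impI)
  fix t assume t: "t \<in> {t. a + t *s b \<in> \<Omega>}"
  then show "\<phi> (a + t *s b) < \<infinity>" using assms by (auto simp: usc_on_def)
  fix c assume c: "\<phi> (a + t *s b) < c"
  then have "\<forall>\<^sub>F y in at (a + t *s b) within \<Omega>. \<phi> y < c"
    using assms t by (auto simp: usc_on_def)
  then obtain T where T: "open T" "a + t *s b \<in> T"
    "\<And>y. y \<in> T \<Longrightarrow> y \<noteq> a + t *s b \<Longrightarrow> y \<in> \<Omega> \<Longrightarrow> \<phi> y < c"
    unfolding eventually_at_topological by blast
  have "open ((\<lambda>t. a + t *s b) -` T)"
    using T(1) by (intro open_vimage continuous_intros linear_continuous_on bounded_linear_vector_scalar_mult_left)
  moreover have "\<phi> (a + s *s b) < c" if "s \<in> (\<lambda>t. a + t *s b) -` T" "a + s *s b \<in> \<Omega>" for s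
    using T(3)[of "a + s *s b"] that c by (cases "a + s *s b = a + t *s b") auto
  ultimately show "\<forall>\<^sub>F s in at t within {t. a + t *s b \<in> \<Omega>}. \<phi> (a + s *s b) < c"
    unfolding eventually_at_topological using T(2) by (intro exI[of _ "(\<lambda>t. a + t *s b) -` T"]) auto
qed

text \<open>Maximum principle: otherwise a small multiple of \<open>\<bar>t - c\<bar>\<^sup>2\<close> can be added to
  \<open>\<phi> (a + t b) - Re (p t)\<close> so that the maximum over the disc is still attained in the interior.\<close>

lemma le_of_harmonic_majorant:
  fixes \<Omega> :: "(complex^'n) set" and \<phi> :: "complex^'n \<Rightarrow> ereal"
  assumes "open \<Omega>" and usc: "usc_on \<Omega> \<phi>" and b: "b \<noteq> 0"
    and ext: "\<And>x e (A :: complex^'n^'n) \<delta>. x \<in> \<Omega> \<Longrightarrow> \<phi> x = ereal e \<Longrightarrow> pos_def_hermitian A \<Longrightarrow> 0 < \<delta> \<Longrightarrow>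
      (+) x ` {z. Re (herm_form A z) \<le> 1} \<subseteq> \<Omega> \<Longrightarrow>
      \<exists>G. mv_holomorphic_on G {z. Re (herm_form A z) < 1} \<and> G 0 = 1 \<and>
        (\<integral>\<^sup>+z\<in>{z. Re (herm_form A z) < 1}. ennreal ((norm (G z))\<^sup>2) * exp_neg (\<phi> (x + z)) \<partial>lborel)
          \<le> ennreal (exp (- e) * measure lborel {z. Re (herm_form A z) < 1} + \<delta>)"
    and r: "0 < r" and disc: "\<And>t. cmod (t - c) \<le> r \<Longrightarrow> a + t *s b \<in> \<Omega>"
    and p: "p holomorphic_on UNIV"
    and maj: "\<And>t. cmod (t - c) = r \<Longrightarrow> \<phi> (a + t *s b) < ereal (Re (p t))"
  shows "\<phi> (a + c *s b) \<le> ereal (Re (p c))"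
proof (rule ccontr)
  assume "\<not> \<phi> (a + c *s b) \<le> ereal (Re (p c))"
  moreover have "\<phi> (a + c *s b) < \<infinity>"
    using usc disc[of c] r by (auto simp: usc_on_def)
  ultimately obtain m where m: "\<phi> (a + c *s b) = ereal m" "Re (p c) < m"
    by (cases "\<phi> (a + c *s b)") auto
  define u where "u t = \<phi> (a + t *s b)" for t
  define U where "U = {t. a + t *s b \<in> \<Omega>}"
  have usc_u: "usc_on U u"
    unfolding U_def u_def using usc by (rule usc_on_line)
  have "open U"
    unfolding U_def using \<open>open \<Omega>\<close> by (rule open_line_preimage)
  \<comment> \<open>The excess of \<phi> over \<open>Re p\<close> at the centre is
    \<open>2 \<eta> r^2\<close>, whereas the added term \<open>\<eta> |t - c|^2\<close> is only
    \<open>\<eta> r^2\<close> on the boundary circle.\<close>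
  define \<eta> where "\<eta> = (m - Re (p c)) / (2 * r\<^sup>2)"
  have \<eta>: "0 < \<eta>" using m(2) r by (simp add: \<eta>_def)
  have \<eta>r: "2 * (\<eta> * r\<^sup>2) = m - Re (p c)" using r by (simp add: \<eta>_def)
  define h where "h t = \<eta> * (cmod (t - c))\<^sup>2 - Re (p t)" for t
  have h_cont: "continuous_on UNIV h"
    unfolding h_def by (intro continuous_intros holomorphic_on_imp_continuous_on p)
  have fin: "u t < \<infinity>" if "t \<in> cball c r" for t
    using usc disc[of t] that by (auto simp: usc_on_def u_def dist_norm norm_minus_commute)
  obtain t0 where t0: "t0 \<in> cball c r" and max: "\<And>t. t \<in> cball c r \<Longrightarrow> u t + ereal (h t) \<le> u t0 + ereal (h t0)"
  proof (rule usc_attains_max[of "cball c r" "\<lambda>t. u t + ereal (h t)"])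
    fix x C assume x: "x \<in> cball c r" "u x + ereal (h x) < C"
    show "\<forall>\<^sub>F y in nhds x. y \<in> cball c r \<longrightarrow> u y + ereal (h y) < C"
    proof (cases C)
      case (real k)
      have "open {y\<in>U. u y < ereal (k - h y)}"
        using h_cont by (intro open_usc_less \<open>open U\<close> usc_u continuous_intros)
      moreover have eq: "u y < ereal (k - h y) \<longleftrightarrow> u y + ereal (h y) < C" for y
        unfolding real by (cases "u y") auto
      moreover have "x \<in> U" using disc[of x] x(1) by (simp add: U_def dist_norm norm_minus_commute)
      ultimately show ?thesis
        unfolding eventually_nhds using x(2) by (intro exI[of _ "{y\<in>U. u y < ereal (k - h y)}"]) auto
    next
      case PInf
      have "y \<in> cball c r \<Longrightarrow> u y + ereal (h y) < C" for y
        unfolding PInf using fin[of y] by (cases "u y") auto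
      then show ?thesis by simp
    next
      case MInf
      then show ?thesis using x(2) by simp
    qed
  qed (use r in auto)
  \<comment> \<open>The maximum is at least the value at the centre, so \<phi> is finite at
    \<open>t0\<close>; boundary values stay below half of that value, so \<open>t0\<close> is an
    interior point.\<close>
  have "u c + ereal (h c) = ereal (2 * (\<eta> * r\<^sup>2))"
    using m \<eta>r by (simp add: u_def h_def)
  then have ge: "ereal (2 * (\<eta> * r\<^sup>2)) \<le> u t0 + ereal (h t0)"
    using max[of c] r by simp
  then obtain e where e: "u t0 = ereal e"
    using fin[OF t0] by (cases "u t0") auto
  have "cmod (t0 - c) \<noteq> r"
  proof
    assume *: "cmod (t0 - c) = r"
    then have "e < Re (p t0)" using maj[OF *] e by (simp add: u_def)
    then have "e + h t0 < \<eta> * r\<^sup>2" by (simp add: h_def *)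
    moreover have "0 < \<eta> * r\<^sup>2" using \<eta> r by simp
    ultimately show False using ge e by simp
  qed
  then have lt: "cmod (t0 - c) < r" using t0 by (simp add: dist_norm norm_minus_commute)
  define r1 where "r1 = r - cmod (t0 - c)"
  have r1: "0 < r1" using lt by (simp add: r1_def)
  have in_disc: "cmod (t0 + s - c) \<le> r" if "cmod s \<le> r1" for s
    using norm_triangle_ineq[of "t0 - c" s] that by (simp add: r1_def algebra_simps)
  \<comment> \<open>Expanding \<open>|t0 + s - c|^2\<close> gives a constant, \<open>|s|^2\<close>
    and the real part of a linear function of \<open>s\<close>. The linear part joins the increment
    of \<open>p\<close> in \<open>q\<close>, so that precisely \<open>- \<eta> |s|^2\<close> is left
    over.\<close>
  define q where "q s = p (t0 + s) - p t0 - complex_of_real (2 * \<eta>) * cnj (t0 - c) * s" for s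
  show False
  proof (rule no_strict_local_max[OF \<open>open \<Omega>\<close> usc b _ _ \<eta> r1, of q "a + t0 *s b" e])
    have "(\<lambda>s. p (t0 + s)) holomorphic_on UNIV"
      using holomorphic_on_compose_gen[of "\<lambda>s. t0 + s" UNIV p UNIV] p
      by (simp add: o_def holomorphic_intros)
    then show "q holomorphic_on UNIV"
      unfolding q_def by (intro holomorphic_intros)
    show "q 0 = 0" by (simp add: q_def)
    show "\<phi> (a + t0 *s b) = ereal e" using e by (simp add: u_def)
    have shift: "a + t0 *s b + s *s b = a + (t0 + s) *s b" for s
      by (simp add: vec_eq_iff algebra_simps)
    show "a + t0 *s b + s *s b \<in> \<Omega>" if "cmod s \<le> r1" for s
      unfolding shift using in_disc[OF that] by (rule disc)
    show "\<phi> (a + t0 *s b + s *s b) \<le> ereal (e + Re (q s) - \<eta> * (cmod s)\<^sup>2)" if "cmod s \<le> r1" for s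
    proof -
      have "u (t0 + s) + ereal (h (t0 + s)) \<le> ereal (e + h t0)"
        using max[of "t0 + s"] in_disc[OF that] e by (simp add: dist_norm norm_minus_commute)
      then have "u (t0 + s) \<le> ereal (e + h t0 - h (t0 + s))"
        by (cases "u (t0 + s)") auto
      moreover have "h t0 - h (t0 + s) = Re (q s) - \<eta> * (cmod s)\<^sup>2"
      proof -
        have eq: "(cmod (t0 + s - c))\<^sup>2 = (cmod (t0 - c))\<^sup>2 + 2 * Re (cnj (t0 - c) * s) + (cmod s)\<^sup>2"
          unfolding cmod_power2 by (simp add: power2_eq_square algebra_simps)
        show ?thesis unfolding h_def eq by (simp add: q_def algebra_simps)
      qed
      ultimately show ?thesis by (simp add: shift u_def add_diff_eq[symmetric])
    qed
    show "\<exists>G. mv_holomorphic_on G {z. Re (herm_form A z) < 1} \<and> G 0 = 1 \<and>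
        (\<integral>\<^sup>+z\<in>{z. Re (herm_form A z) < 1}. ennreal ((norm (G z))\<^sup>2) * exp_neg (\<phi> (a + t0 *s b + z)) \<partial>lborel)
          \<le> ennreal (exp (- e) * measure lborel {z. Re (herm_form A z) < 1} + \<delta>)"
      if "pos_def_hermitian A" "0 < \<delta>" "(+) (a + t0 *s b) ` {z. Re (herm_form A z) \<le> 1} \<subseteq> \<Omega>"
      for A :: "complex^'n^'n" and \<delta>
      using that ext[of "a + t0 *s b" e A \<delta>] disc[of t0] lt e by (simp add: u_def)
  qed
qed

section \<open>Mean values over circles\<close>

text \<open>\<open>Re x * Re y\<close> is the mean of \<open>Re (x y)\<close> and
  \<open>Re (x cnj y)\<close>. On the unit circle \<open>cnj z\<close> is the inverse of
  \<open>z\<close>, so \<open>x cnj y\<close> is a monomial or the conjugate of one, according to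
  which exponent is larger.\<close>

lemma Re_monom_mult_Re_monom:
  "\<exists>S :: complex poly. \<forall>z. cmod z = 1 \<longrightarrow> Re (a * z ^ i) * Re (b * z ^ j) = Re (poly S z)"
proof -
  define T where "T = (if j \<le> i then monom (a * cnj b) (i - j) else monom (cnj a * b) (j - i))"
  have "Re (a * z ^ i) * Re (b * z ^ j) = Re (poly (smult (1/2) (monom (a * b) (i + j) + T)) z)"
    if z: "cmod z = 1" for z
  proof -
    have zz: "z ^ k * cnj z ^ k = 1" for k
    proof -
      have "z * cnj z = 1" using complex_norm_square[of z] z by simp
      then show ?thesis by (simp add: power_mult_distrib[symmetric])
    qed
    have T: "Re (poly T z) = Re (a * z ^ i * cnj (b * z ^ j))"
    proof (cases "j \<le> i")
      case True
      then have "z ^ i = z ^ (i - j) * z ^ j" by (simp add: power_add[symmetric])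
      then have "a * z ^ i * cnj (b * z ^ j) = a * cnj b * z ^ (i - j) * (z ^ j * cnj z ^ j)"
        by (simp add: mult_ac)
      then have "a * z ^ i * cnj (b * z ^ j) = poly T z"
        using True zz[of j] by (simp add: T_def poly_monom)
      then show ?thesis by (simp only:)
    next
      case False
      then have "z ^ j = z ^ (j - i) * z ^ i" by (simp add: power_add[symmetric])
      then have "cnj a * cnj z ^ i * (b * z ^ j) = cnj a * b * z ^ (j - i) * (z ^ i * cnj z ^ i)"
        by (simp add: mult_ac)
      then have "cnj (a * z ^ i * cnj (b * z ^ j)) = poly T z"
        using False zz[of i] by (simp add: T_def poly_monom)
      then show ?thesis by (metis cnj.sel(1))
    qed
    have half: "Re x * Re y = (Re (x * y) + Re (x * cnj y)) / 2" for x y :: complex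
      by (simp add: algebra_simps)
    have "Re (poly (smult (1/2) (monom (a * b) (i + j) + T)) z) = (Re (a * b * z ^ (i + j)) + Re (poly T z)) / 2"
      by (simp add: poly_monom)
    also have "a * b * z ^ (i + j) = (a * z ^ i) * (b * z ^ j)"
      by (simp add: power_add)
    also note T
    also have "(Re ((a * z ^ i) * (b * z ^ j)) + Re (a * z ^ i * cnj (b * z ^ j))) / 2 = Re (a * z ^ i) * Re (b * z ^ j)"
      by (rule half[symmetric])
    finally show ?thesis by (rule sym)
  qed
  then show ?thesis by blast
qed

lemma Re_poly_mult_Re_poly:
  fixes P R :: "complex poly"
  shows "\<exists>S :: complex poly. \<forall>z. cmod z = 1 \<longrightarrow> Re (poly P z) * Re (poly R z) = Re (poly S z)"
proof -
  have "\<forall>i j. \<exists>S :: complex poly. \<forall>z. cmod z = 1 \<longrightarrow> Re (coeff P i * z ^ i) * Re (coeff R j * z ^ j) = Re (poly S z)"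
    by (intro allI Re_monom_mult_Re_monom)
  then obtain S :: "nat \<Rightarrow> nat \<Rightarrow> complex poly" where S:
    "\<And>i j z. cmod z = 1 \<Longrightarrow> Re (coeff P i * z ^ i) * Re (coeff R j * z ^ j) = Re (poly (S i j) z)"
    by metis
  have "Re (poly P z) * Re (poly R z) = Re (poly (\<Sum>i\<le>degree P. \<Sum>j\<le>degree R. S i j) z)"
    if "cmod z = 1" for z
    unfolding poly_altdef[of P] poly_altdef[of R] by (simp only: poly_sum sum_product Re_sum S[OF that])
  then have *: "\<forall>z. cmod z = 1 \<longrightarrow> Re (poly P z) * Re (poly R z) = Re (poly (\<Sum>i\<le>degree P. \<Sum>j\<le>degree R. S i j) z)"
    by simp
  show ?thesis
    by (rule exI[of _ "\<Sum>i\<le>degree P. \<Sum>j\<le>degree R. S i j"]) (rule *)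
qed

text \<open>Induction on the polynomial, products being reduced by
  \<open>Re_poly_mult_Re_poly\<close>. It makes polynomial approximants on the circle boundary
  values of real parts of entire functions, with no Dirichlet problem to solve.\<close>

lemma real_polynomial_function_eq_Re_poly_on_circle:
  fixes h :: "complex \<Rightarrow> real"
  assumes "real_polynomial_function h"
  shows "\<exists>P :: complex poly. \<forall>z. cmod z = 1 \<longrightarrow> h z = Re (poly P z)"
  using assms
proof induction
  case (linear f)
  interpret bounded_linear f by fact
  \<comment> \<open>The coefficient is \<open>f 1 - i f(i)\<close>, since
    \<open>Re ((a - i b) (x + i y)) = a x + b y\<close>.\<close>
  have "f z = Re (poly [:0, Complex (f 1) (- f \<i>):] z)" for z
  proof -
    have "f z = f (Re z *\<^sub>R 1 + Im z *\<^sub>R \<i>)"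
      by (rule arg_cong[of _ _ f]) (simp add: complex_eq_iff)
    then show ?thesis by (simp only: add scaleR) simp
  qed
  then show ?case by blast
next
  case (const c)
  have "c = Re (poly [:complex_of_real c:] z)" for z by simp
  then show ?case by blast
next
  case (add f g)
  from add.IH obtain P R :: "complex poly"
    where "\<forall>z. cmod z = 1 \<longrightarrow> f z = Re (poly P z)" "\<forall>z. cmod z = 1 \<longrightarrow> g z = Re (poly R z)"
    by (elim exE)
  then have "cmod z = 1 \<Longrightarrow> f z + g z = Re (poly (P + R) z)" for z by simp
  then show ?case by blast
next
  case (mult f g)
  from mult.IH obtain P R :: "complex poly"
    where PR: "\<forall>z. cmod z = 1 \<longrightarrow> f z = Re (poly P z)" "\<forall>z. cmod z = 1 \<longrightarrow> g z = Re (poly R z)"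
    by (elim exE)
  obtain S :: "complex poly" where "\<forall>z. cmod z = 1 \<longrightarrow> Re (poly P z) * Re (poly R z) = Re (poly S z)"
    using Re_poly_mult_Re_poly[of P R] by (elim exE)
  with PR have "\<forall>z. cmod z = 1 \<longrightarrow> f z * g z = Re (poly S z)" by simp
  then show ?case by blast
qed

text \<open>Stone-Weierstrass applied to \<open>g + e/2\<close> with tolerance \<open>e/2\<close>
  gives \<open>g < Re P \<le> g + e\<close> on the circle. Then \<open>Re (P 0)\<close> bounds
  \<open>u0\<close> and, being the mean of \<open>Re P\<close>, exceeds the mean of \<open>g\<close>
  by at most \<open>e\<close>.\<close>

lemma le_circle_mean_continuous:
  fixes g :: "complex \<Rightarrow> real" and u0 :: ereal
  assumes maj: "\<And>P :: complex poly. (\<And>z. cmod z = 1 \<Longrightarrow> g z < Re (poly P z)) \<Longrightarrow> u0 \<le> ereal (Re (poly P 0))"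
    and g: "continuous_on (sphere 0 1) g"
  shows "u0 \<le> ereal (integral {0..2 * pi} (\<lambda>t. g (cis t)) / (2 * pi))"
proof (rule ereal_le_epsilon2)
  fix e :: real assume e: "0 < e"
  have "continuous_on (sphere 0 1) (\<lambda>z. g z + e / 2)" "0 < e / 2"
    using g e by (auto intro!: continuous_intros)
  then obtain h where h: "real_polynomial_function h" "\<And>z. z \<in> sphere 0 1 \<Longrightarrow> \<bar>(g z + e / 2) - h z\<bar> < e / 2"
    by (rule Stone_Weierstrass_real_polynomial_function[OF compact_sphere]) (rule that)
  obtain P :: "complex poly" where P: "\<And>z. cmod z = 1 \<Longrightarrow> h z = Re (poly P z)"
    using real_polynomial_function_eq_Re_poly_on_circle[OF h(1)] by blast
  have bounds: "g z < Re (poly P z)" "Re (poly P z) \<le> g z + e" if "cmod z = 1" for z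
  proof -
    have "\<bar>g z + e / 2 - Re (poly P z)\<bar> < e / 2" using h(2)[of z] P[OF that] that by simp
    then show "g z < Re (poly P z)" "Re (poly P z) \<le> g z + e" by linarith+
  qed
  then have u0: "u0 \<le> ereal (Re (poly P 0))" by (intro maj)
  have "Re (poly P 0) \<le> integral {0..2 * pi} (\<lambda>t. g (cis t)) / (2 * pi) + e"
  proof -
    have "continuous_on {0..2 * pi} (\<lambda>t. g (cis t))"
      by (rule continuous_on_compose2[OF g]) (auto intro!: continuous_intros)
    then have "(\<lambda>t. g (cis t)) integrable_on {0..2 * pi}"
      by (rule integrable_continuous_interval)
    then have i1: "((\<lambda>t. g (cis t) + e) has_integral integral {0..2 * pi} (\<lambda>t. g (cis t)) + 2 * pi * e) {0..2 * pi}"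
      using has_integral_const_real[of e 0 "2 * pi"] by (intro has_integral_add) (auto simp: has_integral_integral[symmetric])
    have i2: "((\<lambda>t. Re (poly P (cis t))) has_integral Re (2 * pi * poly P 0)) {0..2 * pi}"
      by (intro has_integral_Re holomorphic_circle_mean holomorphic_intros)
    have "Re (2 * pi * poly P 0) \<le> integral {0..2 * pi} (\<lambda>t. g (cis t)) + 2 * pi * e"
      using i2 i1 by (rule has_integral_le) (simp add: bounds(2))
    then show ?thesis by (simp add: field_simps)
  qed
  then have "ereal (Re (poly P 0)) \<le> ereal (integral {0..2 * pi} (\<lambda>t. g (cis t)) / (2 * pi)) + ereal e"
    unfolding plus_ereal.simps ereal_less_eq .
  with u0 show "u0 \<le> ereal (integral {0..2 * pi} (\<lambda>t. g (cis t)) / (2 * pi)) + ereal e"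
    by (rule order_trans)
qed

text \<open>The Lipschitz approximations are the sup-convolutions of \<open>max w (- k)\<close> with the
  cones \<open>- k \<bar>\<zeta> - \<xi>\<bar>\<close>.\<close>

lemma usc_approx_continuous:
  fixes w :: "complex \<Rightarrow> ereal"
  assumes S: "compact S" "S \<noteq> {}" and C: "0 \<le> C" "\<And>z. z \<in> S \<Longrightarrow> w z \<le> ereal C"
    and usc: "\<And>z c. z \<in> S \<Longrightarrow> w z < c \<Longrightarrow> \<forall>\<^sub>F y in nhds z. y \<in> S \<longrightarrow> w y < c"
  obtains g :: "nat \<Rightarrow> complex \<Rightarrow> real" where
    "\<And>k. continuous_on S (g k)" "\<And>k z. z \<in> S \<Longrightarrow> w z \<le> ereal (g k z)" "\<And>k z. z \<in> S \<Longrightarrow> g k z \<le> C"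
    "\<And>z. z \<in> S \<Longrightarrow> (\<lambda>k. ereal (g k z)) \<longlonglongrightarrow> w z"
proof -
  \<comment> \<open>Truncation at \<open>- k\<close> keeps the values real where \<open>w\<close> is
    minus infinity.\<close>
  define m where "m k z = real_of_ereal (max (w z) (ereal (- real k)))" for k z
  have m: "ereal (m k z) = max (w z) (ereal (- real k))" if "z \<in> S" for k z
    using C(2)[OF that] unfolding m_def by (cases "w z") (auto simp: max_def)
  have m_le: "m k z \<le> C" if "z \<in> S" for k z
  proof -
    have "ereal (m k z) \<le> ereal C" unfolding m[OF that] using C(1) C(2)[OF that] by simp
    then show ?thesis by simp
  qed
  have m_le_diff: "m k y - real k * dist z y \<le> C" if "y \<in> S" for k y z
  proof -
    have "0 \<le> real k * dist z y" by simp
    then show ?thesis using m_le[OF that, of k] by linarith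
  qed
  define g where "g k z = (SUP y\<in>S. m k y - real k * dist z y)" for k z
  have bdd: "bdd_above ((\<lambda>y. m k y - real k * dist z y) ` S)" for k z
    using m_le_diff by (rule bdd_aboveI2)
  have g_upper: "m k y - real k * dist z y \<le> g k z" if "y \<in> S" for k y z
    unfolding g_def using that bdd by (rule cSUP_upper)
  have g_least: "g k z \<le> B" if "\<And>y. y \<in> S \<Longrightarrow> m k y - real k * dist z y \<le> B" for k z B
    unfolding g_def using S(2) that by (rule cSUP_least)
  have lip: "g k z \<le> g k z' + real k * dist z z'" for k z z'
  proof (rule g_least)
    fix y assume y: "y \<in> S"
    have "real k * dist z' y \<le> real k * (dist z z' + dist z y)"
      using dist_triangle3[of z' y z] by (intro mult_left_mono) (auto simp: dist_commute)
    then show "m k y - real k * dist z y \<le> g k z' + real k * dist z z'"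
      using g_upper[OF y, of k z'] by (simp add: distrib_left)
  qed
  show ?thesis
  proof (rule that[of g])
    fix k
    have "(real k)-lipschitz_on S (g k)"
    proof (rule lipschitz_onI)
      fix x y
      show "dist (g k x) (g k y) \<le> real k * dist x y"
        using lip[of k x y] lip[of k y x] by (simp add: dist_real_def abs_le_iff dist_commute)
    qed simp
    then show "continuous_on S (g k)" by (rule lipschitz_on_continuous_on)
  next
    fix k z assume z: "z \<in> S"
    have w_le: "w z \<le> ereal (g k z)" for k
    proof -
      have "w z \<le> ereal (m k z)" by (simp add: m[OF z])
      also have "\<dots> \<le> ereal (g k z)" using g_upper[OF z, of k z] by simp
      finally show ?thesis .
    qed
    then show "w z \<le> ereal (g k z)" .
    show "g k z \<le> C"
      using m_le_diff by (rule g_least)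
    show "(\<lambda>k. ereal (g k z)) \<longlonglongrightarrow> w z"
    proof (rule order_tendstoI)
      fix a assume "a < w z"
      then show "\<forall>\<^sub>F k in sequentially. a < ereal (g k z)"
        by (intro always_eventually allI less_le_trans[OF _ w_le])
    next
      fix a assume "w z < a"
      then obtain c where c: "w z < ereal c" "ereal c < a"
        using ereal_dense2 by blast
      obtain d where d: "d > 0" "\<And>y. dist y z < d \<Longrightarrow> y \<in> S \<Longrightarrow> w y < ereal c"
        using usc[OF z c(1)] unfolding eventually_nhds_metric by blast
      have "\<forall>\<^sub>F k in sequentially. max \<bar>c\<bar> ((C - c) / d) \<le> real k"
        by (rule eventually_ge_at_top[THEN filterlim_real_sequentially[unfolded filterlim_iff, rule_format]])
      then show "\<forall>\<^sub>F k in sequentially. ereal (g k z) < a"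
      proof eventually_elim
        case (elim k)
        \<comment> \<open>Near \<open>z\<close> both \<open>w\<close> and the truncation level
          \<open>- k\<close> are at most \<open>c\<close>; at distance at least \<open>d\<close> the
          cone penalty \<open>k d\<close> is at least \<open>C - c\<close>.\<close>
        have "g k z \<le> c"
        proof (rule g_least)
          fix y assume y: "y \<in> S"
          show "m k y - real k * dist z y \<le> c"
          proof (cases "dist y z < d")
            case True
            have "ereal (m k y) \<le> ereal c"
              unfolding m[OF y] using d(2)[OF True y] elim by auto
            then have "m k y \<le> c" by simp
            moreover have "0 \<le> real k * dist z y" by simp
            ultimately show ?thesis by linarith
          next
            case False
            have "C - c \<le> real k * d" using elim d(1) by (simp add: field_simps)
            also have "\<dots> \<le> real k * dist z y" using False by (intro mult_left_mono) (auto simp: dist_commute)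
            finally show ?thesis using m_le[OF y, of k] by linarith
          qed
        qed
        then have "ereal (g k z) \<le> ereal c" by simp
        then show ?case using c(2) by (rule le_less_trans)
      qed
    qed
  qed
qed

text \<open>The inequality for the continuous approximants \<open>g k\<close> passes to
  \<open>w\<close> by Fatou's lemma for the nonnegative functions \<open>C - g k\<close>. It then
  remains to rewrite the integral of \<open>C - w\<close> through positive and negative
  parts.\<close>

lemma le_circle_mean_usc:
  fixes w :: "complex \<Rightarrow> ereal" and u0 :: ereal
  assumes fin: "\<And>z. cmod z = 1 \<Longrightarrow> w z < \<infinity>"
    and usc: "\<And>z c. cmod z = 1 \<Longrightarrow> w z < c \<Longrightarrow> \<forall>\<^sub>F y in nhds z. cmod y = 1 \<longrightarrow> w y < c"
    and maj: "\<And>P :: complex poly. (\<And>z. cmod z = 1 \<Longrightarrow> w z < ereal (Re (poly P z))) \<Longrightarrow> u0 \<le> ereal (Re (poly P 0))"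
  shows "u0 \<le> ereal (1 / (2 * pi)) * ereal_integral (restrict_space lborel {0..2 * pi}) (\<lambda>t. w (cis t))"
proof (cases "u0 = -\<infinity>")
  case False
  define S where "S = sphere (0::complex) 1"
  have S: "compact S" "S \<noteq> {}" "\<And>z. z \<in> S \<longleftrightarrow> cmod z = 1" by (auto simp: S_def)
  have cis_S: "cis t \<in> S" for t by (simp add: S)
  obtain y where y: "y \<in> S" "\<And>z. z \<in> S \<Longrightarrow> w z \<le> w y"
    by (rule usc_attains_max[OF S(1,2), of w]) (use usc S(3) in auto)
  define C where "C = max 0 (real_of_ereal (w y))"
  have C: "0 \<le> C" "\<And>z. z \<in> S \<Longrightarrow> w z \<le> ereal C"
  proof -
    have "w y \<le> ereal C" using fin[of y] y(1) S(3) unfolding C_def by (cases "w y") auto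
    then show "\<And>z. z \<in> S \<Longrightarrow> w z \<le> ereal C" using y(2) order_trans by blast
  qed (simp add: C_def)
  obtain g where g: "\<And>k. continuous_on S (g k)" "\<And>k z. z \<in> S \<Longrightarrow> w z \<le> ereal (g k z)" "\<And>k z. z \<in> S \<Longrightarrow> g k z \<le> C"
    "\<And>z. z \<in> S \<Longrightarrow> (\<lambda>k. ereal (g k z)) \<longlonglongrightarrow> w z"
  proof (rule usc_approx_continuous[OF S(1,2) C])
    show "\<forall>\<^sub>F y in nhds z. y \<in> S \<longrightarrow> w y < c" if "z \<in> S" "w z < c" for z c
      using usc[of z c] that unfolding S(3) .
  qed auto
  have mean: "u0 \<le> ereal (integral {0..2 * pi} (\<lambda>t. g k (cis t)) / (2 * pi))" for k
  proof (rule le_circle_mean_continuous)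
    show "continuous_on (sphere 0 1) (g k)" using g(1) by (simp add: S_def)
    fix P :: "complex poly" assume P: "\<And>z. cmod z = 1 \<Longrightarrow> g k z < Re (poly P z)"
    show "u0 \<le> ereal (Re (poly P 0))"
    proof (rule maj)
      fix z :: complex assume z: "cmod z = 1"
      then have "w z \<le> ereal (g k z)" by (intro g(2)) (simp add: S(3))
      also have "\<dots> < ereal (Re (poly P z))" using P[OF z] by simp
      finally show "w z < ereal (Re (poly P z))" .
    qed
  qed
  obtain d where d: "u0 = ereal d" using mean[of 0] False by (cases u0) auto
  have g_cont: "continuous_on A (\<lambda>t. g k (cis t))" for k A
    by (rule continuous_on_compose2[OF g(1)]) (use cis_S in \<open>auto intro!: continuous_intros\<close>)
  then have [measurable]: "(\<lambda>t. g k (cis t)) \<in> borel_measurable borel" for k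
    by (rule borel_measurable_continuous_onI)
  have [measurable]: "(\<lambda>t. w (cis t)) \<in> borel_measurable borel"
    by (rule borel_measurable_LIMSEQ_order[where u = "\<lambda>k t. ereal (g k (cis t))"]) (use g(4) cis_S in auto)
  define D where "D = (\<integral>\<^sup>+t\<in>{0..2 * pi}. e2ennreal (ereal C - w (cis t)) \<partial>lborel)"
  have int_g: "(\<integral>\<^sup>+t\<in>{0..2 * pi}. ennreal (C - g k (cis t)) \<partial>lborel) \<le> ennreal (2 * pi * (C - d))" for k
  proof -
    have "((\<lambda>t. g k (cis t)) has_integral integral {0..2 * pi} (\<lambda>t. g k (cis t))) {0..2 * pi}"
      using g_cont by (intro integrable_integral integrable_continuous_interval)
    then have "((\<lambda>t. C - g k (cis t)) has_integral (2 * pi * C - integral {0..2 * pi} (\<lambda>t. g k (cis t)))) {0..2 * pi}"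
      using has_integral_const_real[of C 0 "2 * pi"] by (intro has_integral_diff) auto
    then have "(\<integral>\<^sup>+t. ennreal (C - g k (cis t)) * indicator {0..2 * pi} t \<partial>lborel)
       = ennreal (2 * pi * C - integral {0..2 * pi} (\<lambda>t. g k (cis t)))"
      using g(3)[OF cis_S] by (intro nn_integral_has_integral_lebesgue') auto
    also have "\<dots> \<le> ennreal (2 * pi * (C - d))"
      using mean[of k] unfolding d by (intro ennreal_leI) (simp add: field_simps)
    finally show ?thesis .
  qed
  \<comment> \<open>Fatou needs only pointwise convergence, and it covers points where
    \<open>w\<close> is minus infinity.\<close>
  have "D = (\<integral>\<^sup>+t. liminf (\<lambda>k. ennreal (C - g k (cis t)) * indicator {0..2 * pi} t) \<partial>lborel)"
    unfolding D_def
  proof (intro nn_integral_cong lim_imp_Liminf[symmetric])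
    fix t
    have "(\<lambda>k. ereal C - ereal (g k (cis t))) \<longlonglongrightarrow> ereal C - w (cis t)"
      by (intro tendsto_diff_ereal_general tendsto_const g(4) cis_S) auto
    then have "(\<lambda>k. e2ennreal (ereal C - ereal (g k (cis t)))) \<longlonglongrightarrow> e2ennreal (ereal C - w (cis t))"
      by (rule tendsto_e2ennrealI)
    then show "(\<lambda>k. ennreal (C - g k (cis t)) * indicator {0..2 * pi} t) \<longlonglongrightarrow> e2ennreal (ereal C - w (cis t)) * indicator {0..2 * pi} t"
      by (cases "t \<in> {0..2 * pi}") (simp_all add: e2ennreal_ereal)
  qed simp
  also have "\<dots> \<le> liminf (\<lambda>k. \<integral>\<^sup>+t. ennreal (C - g k (cis t)) * indicator {0..2 * pi} t \<partial>lborel)"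
    by (intro nn_integral_liminf) measurable
  also have "\<dots> \<le> liminf (\<lambda>k :: nat. ennreal (2 * pi * (C - d)))"
    by (intro Liminf_mono always_eventually allI int_g)
  also have "\<dots> = ennreal (2 * pi * (C - d))"
    by (intro lim_imp_Liminf tendsto_const) simp
  finally have D: "D \<le> ennreal (2 * pi * (C - d))" .
  define P where "P = (\<integral>\<^sup>+t\<in>{0..2 * pi}. e2ennreal (w (cis t)) \<partial>lborel)"
  define N where "N = (\<integral>\<^sup>+t\<in>{0..2 * pi}. e2ennreal (- w (cis t)) \<partial>lborel)"
  \<comment> \<open>Integrating \<open>(C - w) + w^+ = C + w^-\<close> relates the three integrals
    by sums only, so no infinities are subtracted; finiteness of \<open>N\<close> is read off
    afterwards.\<close>
  have "D + P = (\<integral>\<^sup>+t. e2ennreal (ereal C - w (cis t)) * indicator {0..2 * pi} t + e2ennreal (w (cis t)) * indicator {0..2 * pi} t \<partial>lborel)"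
    unfolding D_def P_def by (intro nn_integral_add[symmetric]) measurable
  also have "\<dots> = (\<integral>\<^sup>+t. ennreal C * indicator {0..2 * pi} t + e2ennreal (- w (cis t)) * indicator {0..2 * pi} t \<partial>lborel)"
  proof (intro nn_integral_cong)
    fix t
    have "e2ennreal (ereal C - w (cis t)) + e2ennreal (w (cis t)) = ennreal C + e2ennreal (- w (cis t))"
    proof (cases "w (cis t)")
      case (real x)
      have "ennreal (C - x) + ennreal x = ennreal C + ennreal (- x)"
        using C(1) C(2)[OF cis_S, of t] real
        by (cases "0 \<le> x") (auto simp: ennreal_plus[symmetric] ennreal_neg simp del: ennreal_plus)
      then show ?thesis by (simp add: real e2ennreal_ereal)
    next
      case PInf
      then show ?thesis using C(2)[OF cis_S, of t] by simp
    next
      case MInf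
      then show ?thesis by (simp add: e2ennreal_infty)
    qed
    then show "e2ennreal (ereal C - w (cis t)) * indicator {0..2 * pi} t + e2ennreal (w (cis t)) * indicator {0..2 * pi} t
      = ennreal C * indicator {0..2 * pi} t + e2ennreal (- w (cis t)) * indicator {0..2 * pi} t"
      by (simp add: indicator_def)
  qed
  also have "\<dots> = ennreal (2 * pi * C) + N"
    unfolding N_def using C(1) by (subst nn_integral_add) (auto simp: nn_integral_cmult ennreal_mult' mult.commute)
  finally have eq: "D + P = ennreal (2 * pi * C) + N" .
  have "P \<le> (\<integral>\<^sup>+t. ennreal C * indicator {0..2 * pi} t \<partial>lborel)"
    unfolding P_def
  proof (intro nn_integral_mono mult_right_mono)
    fix t
    show "e2ennreal (w (cis t)) \<le> ennreal C"
      using e2ennreal_mono[OF C(2)[OF cis_S, of t]] by (simp add: e2ennreal_ereal)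
  qed simp
  also have "\<dots> < top" by (simp add: nn_integral_cmult ennreal_mult_less_top)
  finally obtain p where p: "P = ennreal p" "0 \<le> p" by (cases P) auto
  obtain x where x: "D = ennreal x" "0 \<le> x" using D by (cases D) (auto simp: top_unique)
  have "N \<noteq> top" using eq p x by auto
  then obtain n where n: "N = ennreal n" "0 \<le> n" by (cases N) auto
  have sum: "x + p = 2 * pi * C + n"
    using eq p n x C(1) by (simp add: ennreal_plus[symmetric] del: ennreal_plus)
  \<comment> \<open>Since \<open>ennreal\<close> sends negative numbers to 0, returning to the reals
    requires \<open>d \<le> C\<close>, which follows from the mean of \<open>g 0\<close>.\<close>
  have "x \<le> 2 * pi * (C - d)"
  proof (cases "0 \<le> 2 * pi * (C - d)")
    case True
    then show ?thesis using D x by (simp add: ennreal_le_iff)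
  next
    case False
    have "d \<le> integral {0..2 * pi} (\<lambda>t. g 0 (cis t)) / (2 * pi)" using mean[of 0] d by simp
    then have "2 * pi * d \<le> integral {0..2 * pi} (\<lambda>t. g 0 (cis t))" by (simp add: field_simps)
    also have "\<dots> \<le> integral {0..2 * pi} (\<lambda>t. C)"
      using g_cont g(3) cis_S by (intro integral_le integrable_continuous_interval) auto
    also have "\<dots> = 2 * pi * C" by simp
    finally have "0 \<le> 2 * pi * (C - d)" by (simp only: right_diff_distrib diff_ge_0_iff_ge)
    with False show ?thesis by simp
  qed
  then have "2 * pi * d \<le> p - n" using sum unfolding right_diff_distrib by linarith
  then have "d \<le> 1 / (2 * pi) * (p - n)" by (simp add: field_simps)
  then have "u0 \<le> ereal (1 / (2 * pi)) * ereal (p - n)"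
    unfolding d times_ereal.simps ereal_less_eq .
  also have "ereal (p - n) = ereal_integral (restrict_space lborel {0..2 * pi}) (\<lambda>t. w (cis t))"
    using p n by (simp add: ereal_integral_def nn_integral_restrict_space P_def[symmetric] N_def[symmetric])
  finally show ?thesis .
next
  case True
  show ?thesis unfolding True by (rule ereal_less_eq(2))
qed

section \<open>The submean inequality for \<phi> on complex lines\<close>

theorem theoremD:
  fixes \<Omega> :: "(complex^'n) set" and \<phi> :: "complex^'n \<Rightarrow> ereal"
  assumes domain: "open \<Omega>" "connected \<Omega>" "\<Omega> \<noteq> {}"
    and usc: "usc_on \<Omega> \<phi>"
    and loc_int: "locally_nn_integrable_on (\<lambda>y. exp_neg (\<phi> y)) \<Omega>"
    and limsup: "\<And>x A. x \<in> \<Omega> \<Longrightarrow> pos_def_hermitian A \<Longrightarrow>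
      Limsup (at_right (0::real)) (\<lambda>\<epsilon>.
          (\<integral>\<^sup>+y \<in> (+) x ` (*\<^sub>R) \<epsilon> ` ellipsoid A. exp_neg (\<phi> y) \<partial>lborel)
            / emeasure lborel ((*\<^sub>R) \<epsilon> ` ellipsoid A))
        \<le> exp_neg (\<phi> x)"
    and ext: "\<And>x A \<theta>. x \<in> \<Omega> \<Longrightarrow> pos_def_hermitian A \<Longrightarrow> 0 < \<theta> \<Longrightarrow> \<theta> < pi / 2 \<Longrightarrow>
      (+) x ` ellipsoid A \<subseteq> \<Omega> \<Longrightarrow>
      \<exists>L :: complex^'n^'n. A = L ** conj_transpose L \<and>
        (\<exists>F G. mv_holomorphic_on F ((+) x ` ellipsoid A) \<and>
          mv_holomorphic_on G ((+) x ` ellipsoid A) \<and>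
          (\<forall>y \<in> (+) x ` ellipsoid A. F y + G y = 1) \<and>
          ennreal (1 / (sin \<theta>)\<^sup>2) *
              (\<integral>\<^sup>+y \<in> (+) x ` ellipsoid A. ennreal ((norm (G y))\<^sup>2) * exp_neg (\<phi> y) \<partial>lborel)
            + ennreal (1 / (cos \<theta>)\<^sup>2) *
              (\<integral>\<^sup>+y \<in> (+) x ` ellipsoid A.
                ennreal ((norm (F y))\<^sup>2 / norm ((y - x) v* L) ^ (2 * CARD('n))) * exp_neg (\<phi> y)
                \<partial>lborel)
            \<le> (\<integral>\<^sup>+y \<in> (+) x ` ellipsoid A.
                ennreal (1 / ((sin \<theta>)\<^sup>2 + norm ((y - x) v* L) ^ (2 * CARD('n)) * (cos \<theta>)\<^sup>2)\<^sup>2)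
                  * exp_neg (\<phi> y) \<partial>lborel))"
  shows "plurisubharmonic_on \<Omega> \<phi>"
proof -
  have extension: "\<exists>G. mv_holomorphic_on G {z. Re (herm_form A z) < 1} \<and> G 0 = 1 \<and>
        (\<integral>\<^sup>+z\<in>{z. Re (herm_form A z) < 1}. ennreal ((norm (G z))\<^sup>2) * exp_neg (\<phi> (x + z)) \<partial>lborel)
          \<le> ennreal (exp (- e) * measure lborel {z. Re (herm_form A z) < 1} + \<delta>)"
    if x: "x \<in> \<Omega>" and e: "\<phi> x = ereal e" and A: "pos_def_hermitian A" and \<delta>: "0 < \<delta>"
      and sub: "(+) x ` {z. Re (herm_form A z) \<le> 1} \<subseteq> \<Omega>"
    for x e \<delta> and A :: "complex^'n^'n"
  proof -
    have "\<forall>\<^sub>F y in at x. \<phi> y < ereal (e + 1)"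
      using usc_onD(2)[OF usc x, of "ereal (e + 1)"] e at_within_open[OF x domain(1)] by simp
    then have "\<forall>\<^sub>F y in nhds x. \<phi> y < ereal (e + 1)"
      using e by (simp add: eventually_nhds_conv_at)
    \<comment> \<open>Upper semicontinuity of \<phi> bounds its exponential weight away from zero
      near \<open>x\<close>, as the vanishing of \<open>F\<close> at \<open>x\<close>
      requires.\<close>
    then have low: "\<forall>\<^sub>F y in nhds x. ennreal (exp (- (e + 1))) \<le> exp_neg (\<phi> y)"
    proof eventually_elim
      case (elim y)
      then show ?case
        by (cases "\<phi> y") (auto simp: exp_neg_def intro!: ennreal_leI)
    qed
    have "exp_neg (\<phi> x) = ennreal (exp (- e))"
      by (simp add: e exp_neg_def)
    then have lim: "Limsup (at_right (0::real)) (\<lambda>\<epsilon>.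
          (\<integral>\<^sup>+y \<in> (+) x ` (*\<^sub>R) \<epsilon> ` ellipsoid A. exp_neg (\<phi> y) \<partial>lborel)
            / emeasure lborel ((*\<^sub>R) \<epsilon> ` ellipsoid A)) \<le> ennreal (exp (- e))"
      using limsup[OF x A] by (simp only:)
    have sub': "(+) x ` ellipsoid A \<subseteq> \<Omega>"
      using sub by (auto simp: ellipsoid_def)
    obtain G where "mv_holomorphic_on G {z. Re (herm_form A z) < 1}" "G 0 = 1"
      "(\<integral>\<^sup>+z\<in>{z. Re (herm_form A z) < 1}. ennreal ((norm (G z))\<^sup>2) * exp_neg (\<phi> (x + z)) \<partial>lborel)
        \<le> ennreal (exp (- e) * measure lborel {z. Re (herm_form A z) < 1} + \<delta>)"
      by (rule exists_extension[OF A loc_int domain(1) sub lim _ low _ \<delta> ext[OF x A _ _ sub']]) auto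
    then show ?thesis by blast
  qed
  have "\<phi> (a + c *s b) \<le> circle_mean (\<lambda>t. \<phi> (a + t *s b)) c r"
    if b: "b \<noteq> 0" and r: "0 < r" and cball: "cball c r \<subseteq> {t. a + t *s b \<in> \<Omega>}" for a b c r
  proof -
    define u where "u t = \<phi> (a + t *s b)" for t
    define U where "U = {t. a + t *s b \<in> \<Omega>}"
    have usc_u: "usc_on U u"
      unfolding U_def u_def using usc by (rule usc_on_line)
    have "open U"
      unfolding U_def using domain(1) by (rule open_line_preimage)
    have in_U: "c + complex_of_real r * z \<in> U" if "cmod z = 1" for z
    proof -
      have "c + complex_of_real r * z \<in> cball c r"
        using that r by (simp add: dist_norm norm_mult)
      then show ?thesis using cball by (auto simp: U_def)
    qed
    \<comment> \<open>The circle of radius \<open>r\<close> around \<open>c\<close> is parametrized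
      by the unit circle, where polynomial majorants are available.\<close>
    have "u c \<le> ereal (1 / (2 * pi)) *
        ereal_integral (restrict_space lborel {0..2 * pi}) (\<lambda>t. u (c + complex_of_real r * cis t))"
    proof (rule le_circle_mean_usc[where w = "\<lambda>z. u (c + complex_of_real r * z)"])
      fix z :: complex assume z: "cmod z = 1"
      show "u (c + complex_of_real r * z) < \<infinity>"
        using usc_onD(1)[OF usc_u in_U[OF z]] .
      fix k assume k: "u (c + complex_of_real r * z) < k"
      have "\<forall>\<^sub>F y in at (c + complex_of_real r * z). u y < k"
        using usc_onD(2)[OF usc_u in_U[OF z] k] at_within_open[OF in_U[OF z] \<open>open U\<close>] by simp
      then have "\<forall>\<^sub>F y in nhds (c + complex_of_real r * z). u y < k"
        using k by (simp add: eventually_nhds_conv_at)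
      moreover have "((\<lambda>y. c + complex_of_real r * y) \<longlongrightarrow> c + complex_of_real r * z) (nhds z)"
        by (intro tendsto_intros) (simp add: filterlim_ident)
      ultimately have "\<forall>\<^sub>F y in nhds z. u (c + complex_of_real r * y) < k"
        by (rule eventually_compose_filterlim)
      then show "\<forall>\<^sub>F y in nhds z. cmod y = 1 \<longrightarrow> u (c + complex_of_real r * y) < k"
        by eventually_elim simp
    next
      fix P :: "complex poly"
      assume P: "\<And>z. cmod z = 1 \<Longrightarrow> u (c + complex_of_real r * z) < ereal (Re (poly P z))"
      \<comment> \<open>The majorant is transported back to the original circle; its value at
        \<open>c\<close> is \<open>poly P 0\<close>.\<close>
      define p where "p t = poly P ((t - c) / complex_of_real r)" for t
      have "\<phi> (a + c *s b) \<le> ereal (Re (p c))"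
      proof (rule le_of_harmonic_majorant[OF domain(1) usc b extension r])
        show "a + t *s b \<in> \<Omega>" if "cmod (t - c) \<le> r" for t
          using cball that by (auto simp: dist_norm norm_minus_commute subset_iff)
        show "p holomorphic_on UNIV"
          unfolding p_def using r by (intro holomorphic_intros) auto
        show "\<phi> (a + t *s b) < ereal (Re (p t))" if "cmod (t - c) = r" for t
          using P[of "(t - c) / complex_of_real r"] that r by (simp add: u_def p_def norm_divide)
      qed
      then show "u c \<le> ereal (Re (poly P 0))" by (simp add: u_def p_def)
    qed
    then show ?thesis by (simp only: u_def circle_mean_def)
  qed
  then show ?thesis
    unfolding plurisubharmonic_on_def subharmonic_on_def
    using usc usc_on_line by blast
qed

end
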